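(* There exists a generalized solution $u$, with corresponding sequences $\{n_k\}$ and $\{u_k\}$, to the Perona-Malik equation $u_t=(\varphi'(u_x))_x$ with homogeneous Neumann boundary conditions in $(0,1)$, obtained through semi-discrete approximation, with the following properties. (1) (Strict convergence of initial data) For $t=0$, $$\liminf_{k\to+\infty}\|u_k(0,\cdot)\|_\infty=\|u(0,\cdot)\|_{\infty}\qquad\text{and}\qquad \liminf_{k\to+\infty}TV(u_k(0,\cdot))=TV(u(0,\cdot)).$$ (2) (Lack of strict convergence for positive times) For every $t>0$, $$\liminf_{k\to+\infty}\|u_k(t,\cdot)\|_\infty>\|u(t,\cdot)\|_{\infty}\qquad\text{and}\qquad \liminf_{k\to+\infty}TV(u_k(t,\cdot))>TV(u(t,\cdot)).$$
   Context: Standing assumptions on $\varphi$: $\varphi:\mathbb{R}\to\mathbb{R}$ is an even function of class $C^2$ with bounded second derivative, $\varphi(0)=0$, $\varphi''(0)>0$; there exists $\sigma_1>0$ such that $\varphi'$ is nondecreasing in $[0,\sigma_1]$ and nonincreasing in $[\sigma_1,+\infty)$; and $\lim_{\sigma\to+\infty}\varphi'(\sigma)=0$. Discrete notation: for a function $w$ of a discrete index and a positive integer $n$, $[D_n^+w](i):=n(w(i+1)-w(i))$ and $[D_n^-w](i):=n(w(i)-w(i-1))$. For $w:\{1,\dots,n\}\to\mathbb{R}$, $\|w\|_\infty:=\max_{1\le i\le n}|w(i)|$ and $TV(w):=\sum_{i=1}^{n-1}|w(i+1)-w(i)|$. Continuous notation: for $u\in BV((0,1))$, identified with its left-continuous representative,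 $TV(u)$ is the total variation in $(0,1)$ (i.e. the total variation of the measure $Du$), and $\|\cdot\|_\infty$ is the $L^\infty((0,1))$ norm. Generalized solution: a generalized solution to $u_t=(\varphi'(u_x))_x$ with homogeneous Neumann boundary conditions in $(0,1)$, obtained through semi-discrete approximation, is any $u\in C^0([0,+\infty);L^2((0,1)))$ for which there exist an increasing sequence $\{n_k\}$ of positive integers and functions $u_k:[0,+\infty)\times\{1,\dots,n_k\}\to\mathbb{R}$ such that: (a) there exists $M\in\mathbb{R}$ with $\|u_k(0,\cdot)\|_\infty+TV(u_k(0,\cdot))\le M$ for every $k\ge1$; (b) for every $k$, $u_k$ is differentiable with respect to the first variable and $$u_k'(t,i)=D_{n_k}^-\left(\varphi'\left(D_{n_k}^+u_k(t,i)\right)\right)=n_k\left\{\varphi'(D^+_{n_k}u_k(t,i))-\varphi'(D^+_{n_k}u_k(t,i-1))\right\}$$ for all $t\ge0$, $i\in\{1,\dots,n_k\}$, where $u_k$ is extended by $u_k(t,0)=u_k(t,1)$ and $u_k(t,n_k+1)=u_k(t,n_k)$ (here $'$ on $u_k$ denotes the time derivative); (c) for every $T>0$, $\lim_{k\to+\infty}\sup_{t\in[0,T]}\|u_k(t,\lceil n_kx\rceil)-u(t,x)\|_{L^2((0,1))}=0$. It is known that for such $u$ one has $u(t,\cdot)\in BV((0,1))$ for every $t\ge0$. *)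

theory Defs
  imports "HOL-Analysis.Analysis" "HOL-Probability.Essential_Supremum"
begin

definition pm_potential :: "(real \<Rightarrow> real) \<Rightarrow> bool" where
  "pm_potential \<phi> \<longleftrightarrow>
     (\<forall>x. \<phi> (- x) = \<phi> x) \<and>
     (\<forall>x. (\<phi> has_real_derivative deriv \<phi> x) (at x)) \<and>
     (\<forall>x. (deriv \<phi> has_real_derivative deriv (deriv \<phi>) x) (at x)) \<and>
     continuous_on UNIV (deriv (deriv \<phi>)) \<and>
     bounded (range (deriv (deriv \<phi>))) \<and>
     \<phi> 0 = 0 \<and>
     deriv (deriv \<phi>) 0 > 0 \<and>
     (\<exists>\<sigma>1>0. mono_on {0..\<sigma>1} (deriv \<phi>) \<and> antimono_on {\<sigma>1..} (deriv \<phi>)) \<and>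
     (deriv \<phi> \<longlongrightarrow> 0) at_top"

text \<open>A function on \<open>{1,...,n}\<close> is an \<open>int \<Rightarrow> real\<close> of which only the values at
  \<open>1,...,n\<close> matter.\<close>

definition Dplus :: "nat \<Rightarrow> (int \<Rightarrow> real) \<Rightarrow> int \<Rightarrow> real" where
  "Dplus n w i = real n * (w (i + 1) - w i)"

definition Dminus :: "nat \<Rightarrow> (int \<Rightarrow> real) \<Rightarrow> int \<Rightarrow> real" where
  "Dminus n w i = real n * (w i - w (i - 1))"

definition neumann_ext :: "nat \<Rightarrow> (int \<Rightarrow> real) \<Rightarrow> int \<Rightarrow> real" where
  "neumann_ext n w i =
     (if i = 0 then w 1 else if i = int n + 1 then w (int n) else w i)"

definition discr_norm :: "nat \<Rightarrow> (int \<Rightarrow> real) \<Rightarrow> real" where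
  "discr_norm n w = Max ((\<lambda>i. \<bar>w i\<bar>) ` {1..int n})"

definition discr_TV :: "nat \<Rightarrow> (int \<Rightarrow> real) \<Rightarrow> real" where
  "discr_TV n w = (\<Sum>i\<in>{1..int n - 1}. \<bar>w (i + 1) - w i\<bar>)"

text \<open>Elements of \<open>L\<^sup>2((0,1))\<close> are represented by functions \<open>real \<Rightarrow> real\<close>; all notions below
  depend only on the almost-everywhere class of the function on \<open>(0,1)\<close>.\<close>

abbreviation unit_leb :: "real measure" where
  "unit_leb \<equiv> lebesgue_on {0<..<1}"

definition L2_unit :: "(real \<Rightarrow> real) set" where
  "L2_unit = {f. f \<in> borel_measurable unit_leb \<and> integrable unit_leb (\<lambda>x. (f x)\<^sup>2)}"

definition L2_norm_unit :: "(real \<Rightarrow> real) \<Rightarrow> real" where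
  "L2_norm_unit f = sqrt (\<integral>x. (f x)\<^sup>2 \<partial>unit_leb)"

definition C0_L2 :: "(real \<Rightarrow> real \<Rightarrow> real) \<Rightarrow> bool" where
  "C0_L2 u \<longleftrightarrow>
     (\<forall>t\<ge>0. u t \<in> L2_unit) \<and>
     (\<forall>t\<ge>0. ((\<lambda>s. L2_norm_unit (\<lambda>x. u s x - u t x)) \<longlongrightarrow> 0) (at t within {0..}))"

definition Linf_norm_unit :: "(real \<Rightarrow> real) \<Rightarrow> ereal" where
  "Linf_norm_unit f = esssup unit_leb (\<lambda>x. ereal \<bar>f x\<bar>)"

definition pointwise_variation :: "(real \<Rightarrow> real) \<Rightarrow> ereal" where
  "pointwise_variation v =
     (SUP (N, p) \<in> {(N :: nat, p :: nat \<Rightarrow> real). mono_on {..N} p \<and> p ` {..N} \<subseteq> {0<..<1}}.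
        ereal (\<Sum>i<N. \<bar>v (p (Suc i)) - v (p i)\<bar>))"

definition left_cont_rep :: "(real \<Rightarrow> real) \<Rightarrow> (real \<Rightarrow> real) \<Rightarrow> bool" where
  "left_cont_rep f v \<longleftrightarrow>
     (AE x in unit_leb. v x = f x) \<and> (\<forall>x\<in>{0<..<1}. (v \<longlongrightarrow> v x) (at_left x))"

text \<open>Total variation in \<open>(0,1)\<close> of the left-continuous representative, i.e. the total variation
  of the measure \<open>Du\<close>. Two left-continuous representatives of the same function agree
  everywhere on \<open>(0,1)\<close>, so the infimum is over a single value, or over the empty set (with
  value \<open>\<infinity>\<close>) if there is no such representative. For \<open>f\<close> in \<open>L2_unit\<close> the value is finite
  precisely when \<open>f\<close> belongs to \<open>BV((0,1))\<close>.\<close>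

definition TV_unit :: "(real \<Rightarrow> real) \<Rightarrow> ereal" where
  "TV_unit f = (INF v \<in> {v. left_cont_rep f v}. pointwise_variation v)"

text \<open>\<open>u\<close> is a generalized solution of \<open>u\<^sub>t = (\<phi>'(u\<^sub>x))\<^sub>x\<close> with homogeneous Neumann boundary
  conditions, obtained through the semi-discrete approximations \<open>U k\<close> on \<open>n k\<close> grid points.
  The supremum in the last condition is taken in \<open>ereal\<close>, since a real-valued \<open>SUP\<close> would be
  unspecified on unbounded sets.\<close>

definition generalized_solution_with ::
  "(real \<Rightarrow> real) \<Rightarrow> (real \<Rightarrow> real \<Rightarrow> real) \<Rightarrow> (nat \<Rightarrow> nat) \<Rightarrow> (nat \<Rightarrow> real \<Rightarrow> int \<Rightarrow> real) \<Rightarrow> bool" where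
  "generalized_solution_with \<phi> u n U \<longleftrightarrow>
     C0_L2 u \<and> strict_mono n \<and> (\<forall>k. n k > 0) \<and>
     (\<exists>M. \<forall>k. discr_norm (n k) (U k 0) + discr_TV (n k) (U k 0) \<le> M) \<and>
     (\<forall>k. \<forall>t\<ge>0. \<forall>i\<in>{1..int (n k)}.
        ((\<lambda>s. U k s i) has_real_derivative
           Dminus (n k) (\<lambda>j. deriv \<phi> (Dplus (n k) (neumann_ext (n k) (U k t)) j)) i)
          (at t within {0..})) \<and>
     (\<forall>T>0. (\<lambda>k. SUP t\<in>{0..T}.
          ereal (L2_norm_unit (\<lambda>x. U k t \<lceil>real (n k) * x\<rceil> - u t x))) \<longlonglongrightarrow> 0)"

end

theory Submission
  imports Defs "HOL-Complex_Analysis.Great_Picard"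
begin

text \<open>
The mechanism. The flux \<open>p = \<phi>'\<close> tends to zero at infinity, so a jump of height \<open>h\<close> between two
neighbouring grid points, whose discrete slope is \<open>n h\<close>, lets almost nothing through. Put on the
left end of the grid a plateau of \<open>m\<close> cells, slightly higher than the rest, with \<open>m / n\<close> small.
It disappears in \<open>L\<^sup>2\<close>, and the slight excess tends to zero, so at time zero neither the sup
norm nor the total variation sees it in the limit. For positive times the part to the right of the
plateau diffuses downwards as if the plateau were an insulating wall, while the plateau itself
keeps its height: at the first cell the discrete solutions stay at least as high as the supremum of the
initial datum, and the limit does not. A one-cell plateau would not do in general, since it sinks at speed \<open>n p (n h)\<close>; a
plateau of \<open>m\<close> cells sinks at speed \<open>n p (n h) / m\<close> on average, and one can choose
\<open>p (n h)\<close> much smaller than \<open>m / n\<close>, and \<open>m / n\<close> small.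

The construction is made odd about the midpoint. Then the right end carries the mirror plateau, the
total variation is twice the value at the first cell, and the left half obeys a Dirichlet
condition in the middle, so that \<open>exp (- 2 \<kappa> t) w\<close> with the concave parabola \<open>w\<close> is an upper
barrier for the diffusing part; this gives the strict decay of the limit.

Slopes must stay in the region where \<open>p\<close> increases, except at the edge of the plateau. To make the
comparison principle available unconditionally, one first solves a modified system, in which \<open>p\<close>
is frozen outside \<open>[- sb, sb]\<close> on ordinary edges and the flux through the plateau edge is forced
into \<open>[- f, 0]\<close>; the bounds of \<open>half_chain_solution\<close> then show that on \<open>[0, T]\<close> the
modifications are never active (\<open>flux_eq\<close>). Past \<open>T\<close> the true equation is continued
arbitrarily, and \<open>T\<close> tends to infinity along the sequence (\<open>plateau_scheme_exists\<close>).

No identification of the limit equation is needed. All discrete solutions decrease in space, and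
their primitives in space are Lipschitz in time because \<open>p\<close> is bounded. By
Arzela and Ascoli the primitives converge locally uniformly along a subsequence, and for monotone
functions uniform closeness of primitives forces closeness in \<open>L\<^sup>2\<close>
(\<open>antimono_family_compactness\<close>).
\<close>

section \<open>Comparison and existence for finite systems of differential equations\<close>

text \<open>A first-crossing argument without strictness assumptions: after multiplication by \<open>exp (- t)\<close> a
negative minimum over the index set and over time would have a strictly positive time derivative
there, although it is approached from the left by values at least as large.\<close>
lemma finite_family_nonneg:
  fixes x x' :: "'i \<Rightarrow> real \<Rightarrow> real"
  assumes fin: "finite I"
    and der: "\<And>i t. \<lbrakk>i \<in> I; 0 \<le> t; t \<le> T\<rbrakk> \<Longrightarrow> (x i has_real_derivative x' i t) (at t within {0..T})"
    and init: "\<And>i. i \<in> I \<Longrightarrow> 0 \<le> x i 0"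
    and drift: "\<And>i t. \<lbrakk>i \<in> I; 0 \<le> t; t \<le> T; x i t < 0; \<And>j. j \<in> I \<Longrightarrow> x i t \<le> x j t\<rbrakk> \<Longrightarrow> 0 \<le> x' i t"
    and i: "i \<in> I" and t: "0 \<le> t" "t \<le> T"
  shows "0 \<le> x i t"
proof (rule ccontr)
  assume neg: "\<not> 0 \<le> x i t"
  define z where "z j s = exp (- s) * x j s" for j s
  have zder: "(z j has_real_derivative (exp (- s) * (x' j s - x j s))) (at s within {0..T})"
    if "j \<in> I" "0 \<le> s" "s \<le> T" for j s
    unfolding z_def by (rule derivative_eq_intros der[OF that] refl | simp add: algebra_simps)+
  have zcont: "continuous_on {0..T} (z j)" if "j \<in> I" for j
    by (rule DERIV_continuous_on, rule zder[OF that]) auto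
  have "\<exists>s\<in>{0..T}. \<forall>r\<in>{0..T}. z j s \<le> z j r" if "j \<in> I" for j
    using t continuous_attains_inf[OF compact_Icc _ zcont[OF that]] by simp
  then obtain s where s: "\<And>j. j \<in> I \<Longrightarrow> s j \<in> {0..T}"
      "\<And>j r. \<lbrakk>j \<in> I; r \<in> {0..T}\<rbrakk> \<Longrightarrow> z j (s j) \<le> z j r"
    by metis
  define m where "m = Min ((\<lambda>j. z j (s j)) ` I)"
  have "m \<in> (\<lambda>j. z j (s j)) ` I"
    unfolding m_def using fin i by (intro Min_in) auto
  then obtain j where j: "j \<in> I" "m = z j (s j)" by auto
  have least: "z j (s j) \<le> z k r" if "k \<in> I" "r \<in> {0..T}" for k r
    using s(2)[OF that] Min_le[of "(\<lambda>j. z j (s j)) ` I" "z k (s k)"] fin that(1) j(2)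
    unfolding m_def by force
  have znegi: "z i t < 0" using neg by (simp add: z_def mult_less_0_iff)
  have zneg: "z j (s j) < 0" using least[OF i, of t] t znegi by auto
  then have xneg: "x j (s j) < 0" by (simp add: z_def mult_less_0_iff)
  have sj: "0 \<le> s j" "s j \<le> T" using s(1)[OF j(1)] by auto
  have "x j (s j) \<le> x k (s j)" if "k \<in> I" for k
    using least[OF that, of "s j"] sj by (simp add: z_def)
  then have "0 \<le> x' j (s j)" using drift[OF j(1) sj xneg] by blast
  then have pos: "0 < exp (- s j) * (x' j (s j) - x j (s j))" using xneg by simp
  have "s j \<noteq> 0" using init[OF j(1)] xneg by auto
  then have sp: "0 < s j" using sj by simp
  obtain d where d: "d > 0" "\<And>h. \<lbrakk>h > 0; s j - h \<in> {0..T}; h < d\<rbrakk> \<Longrightarrow> z j (s j - h) < z j (s j)"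
    using has_real_derivative_pos_inc_left[OF zder[OF j(1) sj] pos] by blast
  define h where "h = min (d / 2) (s j)"
  have h: "h > 0" "h < d" "h \<le> s j" using d(1) sp by (auto simp: h_def)
  have "z j (s j - h) < z j (s j)" using d(2)[of h] h sj by simp
  moreover have "z j (s j) \<le> z j (s j - h)" using least[OF j(1), of "s j - h"] h sj by simp
  ultimately show False by simp
qed

primrec picard :: "(('i \<Rightarrow> real) \<Rightarrow> 'i \<Rightarrow> real) \<Rightarrow> ('i \<Rightarrow> real) \<Rightarrow> nat \<Rightarrow> real \<Rightarrow> 'i \<Rightarrow> real" where
  "picard F x0 0 = (\<lambda>t i. x0 i)"
| "picard F x0 (Suc m) = (\<lambda>t i. x0 i + integral {0..t} (\<lambda>s. F (picard F x0 m s) i))"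

lemma at_within_Icc_eq_Ici:
  fixes t :: real
  assumes "t < T"
  shows "at t within {0..T} = at t within {0..}"
  by (rule at_within_nhd[of t "{..<T}"]) (use assms in auto)

text \<open>Picard iteration, written in coordinates so that the number of equations may vary with the
discretization. The Lipschitz bound also forces \<open>F\<close> to depend on the coordinates in \<open>I\<close> only.\<close>
theorem lipschitz_ode_exists:
  fixes F :: "('i \<Rightarrow> real) \<Rightarrow> 'i \<Rightarrow> real"
  assumes fin: "finite I"
    and lip: "\<And>i x y. i \<in> I \<Longrightarrow> \<bar>F x i - F y i\<bar> \<le> L * (\<Sum>j\<in>I. \<bar>x j - y j\<bar>)"
    and L: "0 \<le> L"
  obtains x where "\<And>i. i \<in> I \<Longrightarrow> x 0 i = x0 i"
    "\<And>i t. \<lbrakk>i \<in> I; 0 \<le> t\<rbrakk> \<Longrightarrow> ((\<lambda>s. x s i) has_real_derivative F (x t) i) (at t within {0..})"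
proof -
  define c where "c = L * real (card I) + 1"
  have c: "c > 0" using L by (simp add: c_def add_nonneg_pos)
  have bnd: "\<bar>F x i - F y i\<bar> \<le> c * e" if "i \<in> I" "\<And>j. j \<in> I \<Longrightarrow> \<bar>x j - y j\<bar> \<le> e" for x y i e
  proof -
    have "e \<ge> 0" using that(2)[OF that(1)] by linarith
    have "\<bar>F x i - F y i\<bar> \<le> L * (\<Sum>j\<in>I. e)"
      by (rule order_trans[OF lip[OF that(1)] mult_left_mono[OF sum_mono[OF that(2)] L]])
    also have "\<dots> = L * real (card I) * e" by simp
    also have "\<dots> \<le> c * e" using \<open>e \<ge> 0\<close> by (simp add: c_def algebra_simps)
    finally show ?thesis .
  qed
  have Fcont: "continuous_on A (\<lambda>t. F (y t) i)"
    if "i \<in> I" "\<And>j. j \<in> I \<Longrightarrow> continuous_on A (\<lambda>t. y t j)" for A :: "real set" and y i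
  proof -
    have "((\<lambda>s. F (y s) i) \<longlongrightarrow> F (y t) i) (at t within A)" if t: "t \<in> A" for t
    proof (rule LIM_zero_cancel)
      have "((\<lambda>s. L * (\<Sum>j\<in>I. \<bar>y s j - y t j\<bar>)) \<longlongrightarrow> L * (\<Sum>j\<in>I. \<bar>y t j - y t j\<bar>)) (at t within A)"
        using that(1) t \<open>\<And>j. j \<in> I \<Longrightarrow> continuous_on A (\<lambda>t. y t j)\<close>
        by (intro tendsto_intros) (auto simp: continuous_on)
      then have *: "((\<lambda>s. L * (\<Sum>j\<in>I. \<bar>y s j - y t j\<bar>)) \<longlongrightarrow> 0) (at t within A)" by simp
      show "((\<lambda>s. F (y s) i - F (y t) i) \<longlongrightarrow> 0) (at t within A)"
        by (rule Lim_null_comparison[OF _ *]) (use lip[OF \<open>i \<in> I\<close>] in auto)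
    qed
    then show ?thesis by (simp add: continuous_on)
  qed
  let ?X = "picard F x0"
  have Ider: "((\<lambda>t. a + integral {0..t} g) has_real_derivative g t) (at t within {0..T})"
    if "continuous_on {0..T} g" "t \<in> {0..T}" for a T t and g :: "real \<Rightarrow> real"
    using integral_has_real_derivative[OF that] by (auto intro!: derivative_eq_intros)
  have Xcont: "continuous_on {0..T} (\<lambda>t. ?X m t i)" if "i \<in> I" for T m i
    using that
  proof (induction m arbitrary: i)
    case (Suc m)
    have "continuous_on {0..T} (\<lambda>s. F (?X m s) i)" using Fcont Suc by blast
    from Ider[OF this] show ?case
      unfolding picard.simps by (rule DERIV_continuous_on)
  qed auto
  have FXcont: "continuous_on {0..T} (\<lambda>s. F (?X m s) i)" if "i \<in> I" for T m i
    using Fcont Xcont that by blast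
  have picard_Suc: "?X (Suc (Suc m)) t i - ?X (Suc m) t i
      = integral {0..t} (\<lambda>s. F (?X (Suc m) s) i) - integral {0..t} (\<lambda>s. F (?X m s) i)" for m t i
    using picard.simps(2)[of F x0 "Suc m", THEN fun_cong, THEN fun_cong]
      picard.simps(2)[of F x0 m, THEN fun_cong, THEN fun_cong] by (metis add_diff_cancel_left)
  define M where "M = (\<Sum>i\<in>I. \<bar>F x0 i\<bar>)"
  define K where "K = M / (2 * c)"
  have M0: "M \<ge> 0" and K0: "K \<ge> 0" using c by (auto simp: M_def K_def intro!: sum_nonneg)
  \<comment> \<open>the weight \<open>exp (2 * c * t)\<close> makes the Picard map a contraction with factor 1/2 on all of [0, \<infinity>)\<close>
  have step: "\<bar>?X (Suc m) t i - ?X m t i\<bar> \<le> K * (1/2)^m * exp (2 * c * t)" if "i \<in> I" "0 \<le> t" for m t i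
    using that
  proof (induction m arbitrary: t i)
    case 0
    have "?X (Suc 0) t i - ?X 0 t i = t * F x0 i"
      using 0 by (simp)
    also have "\<bar>\<dots>\<bar> \<le> t * M"
      using 0 fin member_le_sum[of i I "\<lambda>i. \<bar>F x0 i\<bar>"] by (auto simp: abs_mult M_def intro!: mult_left_mono)
    also have "\<dots> = K * (2 * c * t)" using c by (simp add: K_def)
    also have "\<dots> \<le> K * exp (2 * c * t)"
      using K0 exp_ge_add_one_self[of "2 * c * t"] by (intro mult_left_mono) linarith+
    finally show ?case by simp
  next
    case (Suc m)
    have int: "(\<lambda>s. F (?X m s) i) integrable_on {0..t}" for m
      using FXcont[OF Suc.prems(1)] integrable_continuous_real by blast
    let ?E = "\<lambda>s. K * (1/2)^Suc m * exp (2 * c * s)"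
    have dE: "(?E has_vector_derivative (c * (K * (1/2)^m * exp (2 * c * s)))) (at s within {0..t})" for s
      unfolding has_real_derivative_iff_has_vector_derivative[symmetric]
      by (rule derivative_eq_intros refl | simp)+
    have EI: "((\<lambda>s. c * (K * (1/2)^m * exp (2 * c * s))) has_integral (?E t - ?E 0)) {0..t}"
      by (rule fundamental_theorem_of_calculus[OF Suc.prems(2) dE])
    have "?X (Suc (Suc m)) t i - ?X (Suc m) t i
        = integral {0..t} (\<lambda>s. F (?X (Suc m) s) i - F (?X m s) i)"
      by (simp only: Henstock_Kurzweil_Integration.integral_diff[OF int int] picard_Suc)
    also have "\<bar>\<dots>\<bar> \<le> integral {0..t} (\<lambda>s. c * (K * (1/2)^m * exp (2 * c * s)))"
      unfolding real_norm_def[symmetric]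
    proof (rule integral_norm_bound_integral)
      show "(\<lambda>s. F (?X (Suc m) s) i - F (?X m s) i) integrable_on {0..t}"
        using int integrable_diff by blast
      show "(\<lambda>s. c * (K * (1/2)^m * exp (2 * c * s))) integrable_on {0..t}" using EI by blast
      show "norm (F (?X (Suc m) s) i - F (?X m s) i) \<le> c * (K * (1/2)^m * exp (2 * c * s))"
        if "s \<in> {0..t}" for s
        unfolding real_norm_def
        by (rule bnd[OF Suc.prems(1)]) (use Suc.IH that in auto)
    qed
    also have "\<dots> = ?E t - ?E 0" using EI by (rule integral_unique)
    also have "\<dots> \<le> ?E t" using K0 by simp
    finally show ?case .
  qed
  define x where "x t i = x0 i + (\<Sum>k. ?X (Suc k) t i - ?X k t i)" for t i
  have ulim: "uniform_limit {0..T} (\<lambda>m t. ?X m t i) (\<lambda>t. x t i) sequentially" if "i \<in> I" for T i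
  proof -
    have "uniform_limit {0..T} (\<lambda>m t. \<Sum>k<m. ?X (Suc k) t i - ?X k t i)
            (\<lambda>t. \<Sum>k. ?X (Suc k) t i - ?X k t i) sequentially"
    proof (rule Weierstrass_m_test)
      show "norm (?X (Suc m) t i - ?X m t i) \<le> K * (1/2)^m * exp (2 * c * T)" if "t \<in> {0..T}" for m t
      proof -
        have "K * (1/2)^m * exp (2 * c * t) \<le> K * (1/2)^m * exp (2 * c * T)"
          using that K0 c by (intro mult_left_mono) auto
        then show ?thesis using step[OF \<open>i \<in> I\<close>, of t m] that unfolding real_norm_def by (meson atLeastAtMost_iff order_trans)
      qed
      show "summable (\<lambda>m. K * (1/2)^m * exp (2 * c * T))"
        by (intro summable_mult summable_mult2 summable_geometric) auto
    qed
    then have "uniform_limit {0..T} (\<lambda>m t. x0 i + (\<Sum>k<m. ?X (Suc k) t i - ?X k t i)) (\<lambda>t. x t i) sequentially"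
      unfolding x_def by (intro uniform_limit_intros)
    then show ?thesis by (subst (asm) sum_lessThan_telescope) simp
  qed
  have xeq: "x t i = x0 i + integral {0..t} (\<lambda>s. F (x s) i)" if "i \<in> I" "0 \<le> t" for t i
  proof -
    have "uniform_limit {0..t} (\<lambda>m s. F (?X m s) i) (\<lambda>s. F (x s) i) sequentially"
    proof (rule uniform_limitI)
      fix e :: real assume e: "e > 0"
      have "\<forall>\<^sub>F m in sequentially. \<forall>j\<in>I. \<forall>s\<in>{0..t}. dist (?X m s j) (x s j) < e / (2 * c)"
        using uniform_limitD[OF ulim] fin e c by (intro eventually_ball_finite) auto
      then show "\<forall>\<^sub>F m in sequentially. \<forall>s\<in>{0..t}. dist (F (?X m s) i) (F (x s) i) < e"
      proof eventually_elim
        case (elim m)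
        show ?case
        proof
          fix s assume s: "s \<in> {0..t}"
          have "\<bar>F (?X m s) i - F (x s) i\<bar> \<le> c * (e / (2 * c))"
            by (rule bnd[OF \<open>i \<in> I\<close>]) (use elim s in \<open>force simp: dist_real_def\<close>)
          also have "\<dots> < e" using c e by simp
          finally show "dist (F (?X m s) i) (F (x s) i) < e" by (simp add: dist_real_def)
        qed
      qed
    qed
    then obtain A J where AJ: "\<And>m. ((\<lambda>s. F (?X m s) i) has_integral A m) {0..t}"
        "((\<lambda>s. F (x s) i) has_integral J) {0..t}" "A \<longlonglongrightarrow> J"
      using uniform_limit_integral[where a = 0 and b = t and f = "\<lambda>m s. F (?X m s) i"
          and g = "\<lambda>s. F (x s) i" and F = sequentially]
        FXcont[OF \<open>i \<in> I\<close>] by auto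
    have Aeq: "integral {0..t} (\<lambda>s. F (?X m s) i) = A m" for m by (rule integral_unique[OF AJ(1)])
    have "(\<lambda>m. ?X (Suc m) t i) \<longlonglongrightarrow> x0 i + J"
      unfolding picard.simps Aeq by (intro tendsto_intros AJ(3))
    moreover have "(\<lambda>m. ?X (Suc m) t i) \<longlonglongrightarrow> x t i"
      using tendsto_uniform_limitI[OF ulim[OF that(1)], of t t] that(2) LIMSEQ_Suc by force
    ultimately show ?thesis using AJ(2) LIMSEQ_unique integral_unique by metis
  qed
  have xcont: "continuous_on {0..T} (\<lambda>t. x t i)" if "i \<in> I" for i T
    by (rule uniform_limit_theorem[OF _ ulim[OF that]]) (use Xcont[OF that] in auto)
  show ?thesis
  proof (rule that)
    show "x 0 i = x0 i" if "i \<in> I" for i using xeq[OF that, of 0] by simp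
    show "((\<lambda>s. x s i) has_real_derivative F (x t) i) (at t within {0..})" if i: "i \<in> I" and "0 \<le> t" for i t
    proof -
      have "((\<lambda>s. x0 i + integral {0..s} (\<lambda>s. F (x s) i)) has_real_derivative F (x t) i) (at t within {0..t+1})"
        by (rule Ider[OF Fcont[OF i xcont]]) (use that in auto)
      then have "((\<lambda>s. x s i) has_real_derivative F (x t) i) (at t within {0..t+1})"
        by (rule has_field_derivative_transform_within[where d = 1]) (use xeq[OF i] that in auto)
      then show ?thesis by (simp add: at_within_Icc_eq_Ici)
    qed
  qed
qed

section \<open>Compactness of families of monotone functions\<close>

lemma antimono_on_unit_integrable:
  fixes f :: "real \<Rightarrow> real"
  assumes "antimono_on {0..1} f" "0 \<le> a" "b \<le> 1"
  shows "f integrable_on {a..b}"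
proof -
  have "mono_on {a..b} (\<lambda>x. - f x)"
    using assms by (auto simp: monotone_on_def)
  then have "(\<lambda>x. - f x) integrable_on {a..b}" by (rule integrable_on_mono_on)
  then show ?thesis by (simp add: integrable_neg_iff)
qed

lemma antimono_on_unit_measurable:
  fixes f :: "real \<Rightarrow> real"
  assumes "antimono_on {0..1} f"
  shows "f \<in> borel_measurable unit_leb"
proof -
  have "mono_on {0..1} (\<lambda>x. - f x)"
    using assms by (auto simp: monotone_on_def)
  then have "(\<lambda>x. - f x) \<in> borel_measurable (lebesgue_on {0..1})"
    by (rule borel_measurable_integrable[OF integrable_mono_on])
  then have "(\<lambda>x. - (- f x)) \<in> borel_measurable (lebesgue_on {0..1})"
    by (rule borel_measurable_uminus)
  then show ?thesis
    by (simp add: measurable_restrict_mono[of f lebesgue "{0..1}" borel "{0<..<1}"] subset_iff)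
qed

text \<open>The square of \<open>r = f - g\<close> is \<open>(- g) r - (- f) r\<close>, and integrating \<open>r\<close> against a bounded
monotone weight only sees the primitive of \<open>r\<close>, by the second mean value theorem.\<close>
lemma antimono_integral_diff_sq_le:
  fixes f g :: "real \<Rightarrow> real"
  assumes f: "antimono_on {0..1} f" "\<And>x. x \<in> {0..1} \<Longrightarrow> \<bar>f x\<bar> \<le> B"
    and g: "antimono_on {0..1} g" "\<And>x. x \<in> {0..1} \<Longrightarrow> \<bar>g x\<bar> \<le> B"
    and close: "\<And>x. x \<in> {0..1} \<Longrightarrow> \<bar>integral {0..x} f - integral {0..x} g\<bar> \<le> \<delta>"
  shows "integral {0..1} (\<lambda>x. (f x - g x)\<^sup>2) \<le> 6 * B * \<delta>"
proof -
  let ?r = "\<lambda>x. f x - g x"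
  have B: "B \<ge> 0" using f(2)[of 0] by simp
  have int: "f integrable_on {a..b}" "g integrable_on {a..b}" if "0 \<le> a" "b \<le> 1" for a b
    using antimono_on_unit_integrable that f(1) g(1) by blast+
  have r: "?r integrable_on {0..1}" using int by (intro integrable_diff) auto
  have r0: "\<bar>integral {0..c} ?r\<bar> \<le> \<delta>" if "c \<in> {0..1}" for c
    using close[OF that] that int by (subst Henstock_Kurzweil_Integration.integral_diff) auto
  have r1: "\<bar>integral {c..1} ?r\<bar> \<le> 2 * \<delta>" if "c \<in> {0..1}" for c
  proof -
    have "integral {0..c} ?r + integral {c..1} ?r = integral {0..1} ?r"
      using that r by (intro Henstock_Kurzweil_Integration.integral_combine) auto
    then show ?thesis using r0[OF that] r0[of 1] by auto
  qed
  have half: "(\<lambda>x. - h x * ?r x) integrable_on {0..1} \<and> \<bar>integral {0..1} (\<lambda>x. - h x * ?r x)\<bar> \<le> 3 * B * \<delta>"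
    if h: "antimono_on {0..1} h" "\<And>x. x \<in> {0..1} \<Longrightarrow> \<bar>h x\<bar> \<le> B" for h :: "real \<Rightarrow> real"
  proof -
    obtain c where c: "c \<in> {0..1}"
      "((\<lambda>x. - h x * ?r x) has_integral (- h 0 * integral {0..c} ?r + - h 1 * integral {c..1} ?r)) {0..1}"
      using second_mean_value_theorem_full[OF r, of "\<lambda>x. - h x"] h(1)
      by (force simp: monotone_on_def)
    have "\<bar>- h 0 * integral {0..c} ?r\<bar> \<le> B * \<delta>"
      using h(2)[of 0] r0[OF c(1)] B by (simp add: abs_mult mult_mono)
    moreover have "\<bar>- h 1 * integral {c..1} ?r\<bar> \<le> B * (2 * \<delta>)"
      using h(2)[of 1] r1[OF c(1)] B unfolding abs_mult abs_minus_cancel by (intro mult_mono) auto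
    ultimately show ?thesis using c(2) by (auto simp: has_integral_iff algebra_simps)
  qed
  have "integral {0..1} (\<lambda>x. (f x - g x)\<^sup>2)
      = integral {0..1} (\<lambda>x. - g x * ?r x - - f x * ?r x)"
    by (simp add: power2_eq_square algebra_simps)
  also have "\<dots> = integral {0..1} (\<lambda>x. - g x * ?r x) - integral {0..1} (\<lambda>x. - f x * ?r x)"
    using half[OF f] half[OF g] by (intro Henstock_Kurzweil_Integration.integral_diff) auto
  also have "\<dots> \<le> 6 * B * \<delta>" using half[OF f] half[OF g] by linarith
  finally show ?thesis .
qed

lemma bounded_in_L2_unit:
  assumes "f \<in> borel_measurable unit_leb" "\<And>x. x \<in> {0<..<1} \<Longrightarrow> \<bar>f x\<bar> \<le> B"
  shows "f \<in> L2_unit" "L2_norm_unit f = sqrt (integral {0..1} (\<lambda>x. (f x)\<^sup>2))"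
proof -
  have m: "(\<lambda>x. (f x)\<^sup>2) \<in> borel_measurable unit_leb" using assms(1) by simp
  have i: "integrable unit_leb (\<lambda>x. (f x)\<^sup>2)"
  proof (rule finite_measure.integrable_const_bound[where B="B\<^sup>2"])
    show "finite_measure unit_leb" by (rule finite_measure_lebesgue_on) simp
    have "norm ((f x)\<^sup>2) \<le> B\<^sup>2" if "x \<in> {0<..<1}" for x
      using power_mono[OF assms(2)[OF that], of 2] by simp
    then show "AE x in unit_leb. norm ((f x)\<^sup>2) \<le> B\<^sup>2" by (intro AE_I2) simp
  qed (rule m)
  show "f \<in> L2_unit" using assms(1) i by (simp add: L2_unit_def)
  show "L2_norm_unit f = sqrt (integral {0..1} (\<lambda>x. (f x)\<^sup>2))"
    unfolding L2_norm_unit_def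
    by (subst lebesgue_integral_eq_integral[OF i]) (simp_all add: integral_open_interval_real)
qed

lemma antimono_L2_dist_le:
  fixes f g :: "real \<Rightarrow> real"
  assumes f: "antimono_on {0..1} f" "\<And>x. x \<in> {0..1} \<Longrightarrow> \<bar>f x\<bar> \<le> B"
    and g: "antimono_on {0..1} g" "\<And>x. x \<in> {0..1} \<Longrightarrow> \<bar>g x\<bar> \<le> B"
    and close: "\<And>x. x \<in> {0..1} \<Longrightarrow> \<bar>integral {0..x} f - integral {0..x} g\<bar> \<le> \<delta>"
  shows "L2_norm_unit (\<lambda>x. f x - g x) \<le> sqrt (6 * B * \<delta>)"
proof -
  have "\<bar>f x - g x\<bar> \<le> 2 * B" if "x \<in> {0<..<1}" for x
    using f(2)[of x] g(2)[of x] that by auto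
  then have "L2_norm_unit (\<lambda>x. f x - g x) = sqrt (integral {0..1} (\<lambda>x. (f x - g x)\<^sup>2))"
    by (intro bounded_in_L2_unit(2)[of _ "2 * B"] borel_measurable_diff antimono_on_unit_measurable f(1) g(1))
  then show ?thesis using antimono_integral_diff_sq_le[OF assms] by simp
qed

lemma antimono_integral_bounds:
  fixes f :: "real \<Rightarrow> real"
  assumes f: "antimono_on {0..1} f" and xy: "0 \<le> x" "x \<le> y" "y \<le> 1"
  shows "f y * (y - x) \<le> integral {0..y} f - integral {0..x} f"
    "integral {0..y} f - integral {0..x} f \<le> f x * (y - x)"
proof -
  have c: "integral {0..x} f + integral {x..y} f = integral {0..y} f"
    using xy antimono_on_unit_integrable[OF f] by (intro Henstock_Kurzweil_Integration.integral_combine) auto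
  have i: "f integrable_on {x..y}" using xy antimono_on_unit_integrable[OF f] by auto
  have "integral {x..y} (\<lambda>_. f y) \<le> integral {x..y} f" "integral {x..y} f \<le> integral {x..y} (\<lambda>_. f x)"
    using f xy by (intro integral_le integrable_const_ivl i; force simp: monotone_on_def)+
  then show "f y * (y - x) \<le> integral {0..y} f - integral {0..x} f"
    "integral {0..y} f - integral {0..x} f \<le> f x * (y - x)"
    using c xy by (simp_all add: mult.commute)
qed

text \<open>A difference quotient of the primitive over \<open>[x, y]\<close> lies between the values at \<open>y\<close> and at \<open>x\<close>.
Hence the upper limit of \<open>f k\<close> at \<open>y\<close> is at most the lower limit at any \<open>x < y\<close>, so the two limits
agree wherever the upper limit is continuous, that is, off a countable set.\<close>
lemma antimono_limit_of_primitives: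
  fixes f :: "nat \<Rightarrow> real \<Rightarrow> real"
  assumes f: "\<And>k. antimono_on {0..1} (f k)" "\<And>k x. x \<in> {0..1} \<Longrightarrow> \<bar>f k x\<bar> \<le> B"
    and P: "\<And>x. x \<in> {0..1} \<Longrightarrow> (\<lambda>k. integral {0..x} (f k)) \<longlonglongrightarrow> P x"
  shows "\<exists>g. antimono_on {0..1} g \<and> (\<forall>x\<in>{0..1}. \<bar>g x\<bar> \<le> B) \<and>
    (\<exists>C. countable C \<and> (\<forall>x\<in>{0<..<1} - C. (\<lambda>k. f k x) \<longlonglongrightarrow> g x)) \<and>
    (\<forall>x\<in>{0..1}. integral {0..x} g = P x)"
proof -
  define g where "g x = real_of_ereal (limsup (\<lambda>k. ereal (f k x)))" for x
  have lo: "- B \<le> limsup (\<lambda>k. ereal (f k x))" and hi: "limsup (\<lambda>k. ereal (f k x)) \<le> B"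
    if "x \<in> {0..1}" for x
  proof -
    have "ereal (- B) \<le> liminf (\<lambda>k. ereal (f k x))"
      using f(2)[OF that] by (intro Liminf_bounded always_eventually) (simp add: abs_le_iff minus_le_iff)
    also have "\<dots> \<le> limsup (\<lambda>k. ereal (f k x))" by (rule Liminf_le_Limsup) simp
    finally show "- B \<le> limsup (\<lambda>k. ereal (f k x))" by simp
    show "limsup (\<lambda>k. ereal (f k x)) \<le> B"
      using f(2)[OF that] by (intro Limsup_bounded always_eventually) (simp add: abs_le_iff)
  qed
  have geq: "ereal (g x) = limsup (\<lambda>k. ereal (f k x))" if "x \<in> {0..1}" for x
    using lo[OF that] hi[OF that] unfolding g_def by (cases "limsup (\<lambda>k. ereal (f k x))") auto
  have gB: "\<bar>g x\<bar> \<le> B" if "x \<in> {0..1}" for x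
    using lo[OF that] hi[OF that] unfolding geq[OF that, symmetric] by simp
  have sep: "ereal (g y) \<le> liminf (\<lambda>k. ereal (f k x))" if xy: "0 \<le> x" "x < y" "y \<le> 1" for x y
  proof -
    define a where "a k = (integral {0..y} (f k) - integral {0..x} (f k)) / (y - x)" for k
    have "a \<longlonglongrightarrow> (P y - P x) / (y - x)"
      unfolding a_def using xy by (intro tendsto_intros P) auto
    then have lim: "(\<lambda>k. ereal (a k)) \<longlonglongrightarrow> ereal ((P y - P x) / (y - x))" by simp
    have fa: "f k y \<le> a k" "a k \<le> f k x" for k
      using antimono_integral_bounds[OF f(1), of x y k] xy by (simp_all add: a_def field_simps)
    have "ereal (g y) = limsup (\<lambda>k. ereal (f k y))" using xy by (intro geq) auto
    also have "\<dots> \<le> limsup (\<lambda>k. ereal (a k))" using fa by (intro Limsup_mono always_eventually) simp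
    also have "\<dots> = liminf (\<lambda>k. ereal (a k))"
      using lim lim_imp_Limsup lim_imp_Liminf by (metis trivial_limit_sequentially)
    also have "\<dots> \<le> liminf (\<lambda>k. ereal (f k x))" using fa by (intro Liminf_mono always_eventually) simp
    finally show ?thesis .
  qed
  have ganti: "antimono_on {0..1} g"
  proof (rule monotone_onI)
    fix x y :: real assume xy: "x \<in> {0..1}" "y \<in> {0..1}" "x \<le> y"
    show "g y \<le> g x"
    proof (cases "x = y")
      case False
      then have "ereal (g y) \<le> liminf (\<lambda>k. ereal (f k x))" using xy by (intro sep) auto
      also have "\<dots> \<le> ereal (g x)" unfolding geq[OF xy(1)] by (rule Liminf_le_Limsup) simp
      finally show ?thesis by simp
    qed simp
  qed
  define C where "C = {a\<in>{0<..<1}. \<not> isCont (\<lambda>x. - g x) a}"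
  have "mono_on {0<..<1} (\<lambda>x. - g x)" using ganti by (auto simp: monotone_on_def)
  then have C: "countable C" unfolding C_def by (intro mono_on_ctble_discont_open) auto
  have conv: "(\<lambda>k. f k x) \<longlonglongrightarrow> g x" if x: "x \<in> {0<..<1} - C" for x
  proof -
    have "isCont (\<lambda>x. - g x) x" using x by (auto simp: C_def)
    then have "isCont (\<lambda>x. - (- g x)) x" by (rule isCont_minus)
    then have "(g \<longlongrightarrow> g x) (at_right x)" by (simp add: isCont_def filterlim_at_split)
    then have "((\<lambda>y. ereal (g y)) \<longlongrightarrow> ereal (g x)) (at_right x)" by simp
    moreover have "\<forall>\<^sub>F y in at_right x. ereal (g y) \<le> liminf (\<lambda>k. ereal (f k x))"
      using eventually_at_right_real[of x 1] x by (auto elim!: eventually_mono intro!: sep)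
    ultimately have "ereal (g x) \<le> liminf (\<lambda>k. ereal (f k x))"
      by (rule tendsto_upperbound) simp
    moreover have "ereal (g x) = limsup (\<lambda>k. ereal (f k x))" using x by (intro geq) auto
    moreover have "liminf (\<lambda>k. ereal (f k x)) \<le> limsup (\<lambda>k. ereal (f k x))"
      by (rule Liminf_le_Limsup) simp
    ultimately have "(\<lambda>k. ereal (f k x)) \<longlonglongrightarrow> ereal (g x)"
      by (intro Liminf_eq_Limsup) auto
    then show ?thesis by simp
  qed
  have "integral {0..x} g = P x" if x: "x \<in> {0..1}" for x
  proof -
    define N where "N = C \<union> {0, 1}"
    have "countable N" using C by (simp add: N_def)
    then have N: "negligible N"
      by (simp add: negligible_iff_null_sets null_sets_completionI countable_imp_null_set_lborel)
    define h where "h k y = (if y \<in> N then g y else f k y)" for k y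
    have hint: "integral {0..x} (h k) = integral {0..x} (f k)" for k
      by (rule integral_spike[OF N]) (simp add: h_def)
    have "(\<lambda>k. integral {0..x} (h k)) \<longlonglongrightarrow> integral {0..x} g"
    proof (rule dominated_convergence(2))
      show "h k integrable_on {0..x}" for k
        by (rule integrable_spike[OF antimono_on_unit_integrable[OF f(1)[of k], of 0 x] N])
           (use x in \<open>auto simp: h_def\<close>)
      show "(\<lambda>_. B) integrable_on {0..x}" by (rule integrable_const_ivl)
      show "norm (h k y) \<le> B" if "y \<in> {0..x}" for k y
        using that x gB[of y] f(2)[of y k] by (simp add: h_def)
      show "(\<lambda>k. h k y) \<longlonglongrightarrow> g y" if "y \<in> {0..x}" for y
      proof (cases "y \<in> N")
        case False
        then have "y \<in> {0<..<1} - C" using that x by (auto simp: N_def less_le)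
        then show ?thesis using conv[of y] False by (simp add: h_def)
      qed (simp add: h_def)
    qed
    then show ?thesis using P[OF x] LIMSEQ_unique unfolding hint by blast
  qed
  then show ?thesis using ganti gB C conv by blast
qed

text \<open>The substitution \<open>t = - ln \<tau>\<close> maps the half line of times to \<open>(0, 1]\<close>, and the weight \<open>\<tau>\<close> keeps
the Lipschitz constant under control up to \<open>\<tau> = 0\<close>. One application of the Arzela-Ascoli theorem
on the compact unit square then handles all time intervals at once, without a diagonal argument.\<close>
lemma weighted_log_time_lipschitz:
  fixes P :: "real \<Rightarrow> real \<Rightarrow> real"
  assumes bnd: "\<And>t x. 0 \<le> t \<Longrightarrow> x \<in> {0..1} \<Longrightarrow> \<bar>P t x\<bar> \<le> B"
    and lipx: "\<And>t x y. 0 \<le> t \<Longrightarrow> x \<in> {0..1} \<Longrightarrow> y \<in> {0..1} \<Longrightarrow> \<bar>P t x - P t y\<bar> \<le> B * \<bar>x - y\<bar>"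
    and lipt: "\<And>s t x. 0 \<le> s \<Longrightarrow> 0 \<le> t \<Longrightarrow> x \<in> {0..1} \<Longrightarrow> \<bar>P s x - P t x\<bar> \<le> L * \<bar>s - t\<bar>"
    and L: "0 \<le> L" and \<tau>: "0 \<le> \<tau>" "\<tau> \<le> \<tau>'" "\<tau>' \<le> 1" and xy: "x \<in> {0..1}" "y \<in> {0..1}"
  shows "\<bar>\<tau> * P (- ln \<tau>) x - \<tau>' * P (- ln \<tau>') y\<bar> \<le> (B + L) * \<bar>\<tau> - \<tau>'\<bar> + B * \<bar>x - y\<bar>"
proof -
  have B: "0 \<le> B" using bnd[of 0 x] xy by auto
  show ?thesis
  proof (cases "\<tau> = 0")
    case True
    have "\<bar>\<tau>' * P (- ln \<tau>') y\<bar> \<le> \<tau>' * B"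
    proof (cases "\<tau>' = 0")
      case False
      then have "0 \<le> - ln \<tau>'" using \<tau> True by simp
      then show ?thesis using bnd[OF _ xy(2)] \<tau> by (auto simp: abs_mult intro!: mult_left_mono)
    qed simp
    moreover have "0 \<le> L * \<tau>'" "0 \<le> B * \<bar>x - y\<bar>" using L B \<tau> by auto
    ultimately show ?thesis using True \<tau> by (simp add: algebra_simps)
  next
    case False
    then have pos: "0 < \<tau>" "0 < \<tau>'" using \<tau> by auto
    have s: "0 \<le> - ln \<tau>" "0 \<le> - ln \<tau>'" using pos \<tau> by auto
    have ln: "ln \<tau>' - ln \<tau> \<le> (\<tau>' - \<tau>) / \<tau>" "0 \<le> ln \<tau>' - ln \<tau>"
      using ln_diff_le[OF pos(2,1)] pos \<tau> by auto
    have "\<bar>P (- ln \<tau>) x - P (- ln \<tau>') x\<bar> \<le> L * ((\<tau>' - \<tau>) / \<tau>)"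
      using lipt[OF s xy(1)] mult_left_mono[OF ln(1) L] ln(2) by auto
    then have 1: "\<bar>\<tau> * (P (- ln \<tau>) x - P (- ln \<tau>') x)\<bar> \<le> L * (\<tau>' - \<tau>)"
      using mult_left_mono[of _ _ \<tau>] pos by (fastforce simp: abs_mult)
    have 2: "\<bar>(\<tau> - \<tau>') * P (- ln \<tau>') x\<bar> \<le> (\<tau>' - \<tau>) * B"
      using bnd[OF s(2) xy(1)] \<tau> unfolding abs_mult by (intro mult_mono) auto
    have 3: "\<bar>\<tau>' * (P (- ln \<tau>') x - P (- ln \<tau>') y)\<bar> \<le> 1 * (B * \<bar>x - y\<bar>)"
      using lipx[OF s(2) xy] \<tau> pos unfolding abs_mult by (intro mult_mono) auto
    have "\<tau> * P (- ln \<tau>) x - \<tau>' * P (- ln \<tau>') y = \<tau> * (P (- ln \<tau>) x - P (- ln \<tau>') x)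
       + (\<tau> - \<tau>') * P (- ln \<tau>') x + \<tau>' * (P (- ln \<tau>') x - P (- ln \<tau>') y)"
      by (simp add: algebra_simps)
    moreover have "\<bar>\<tau> - \<tau>'\<bar> = \<tau>' - \<tau>" using \<tau> by simp
    ultimately show ?thesis using 1 2 3 by (simp only: distrib_right) (simp add: mult.commute)
  qed
qed

text \<open>The primitives \<open>P k\<close> are bounded and Lipschitz in both variables, hence converge locally uniformly
along a subsequence. By \<open>antimono_limit_of_primitives\<close> the limits are primitives of monotone
functions, and \<open>antimono_L2_dist_le\<close> transfers the convergence to the functions themselves,
uniformly on bounded time intervals. The time continuity of \<open>u\<close> in \<open>L\<^sup>2\<close> is
the last estimate, applied to \<open>u s\<close> and \<open>u t\<close>.\<close>
theorem antimono_family_compactness: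
  fixes V :: "nat \<Rightarrow> real \<Rightarrow> real \<Rightarrow> real"
  assumes mono: "\<And>k t. 0 \<le> t \<Longrightarrow> antimono_on {0..1} (V k t)"
    and bnd: "\<And>k t x. 0 \<le> t \<Longrightarrow> x \<in> {0..1} \<Longrightarrow> \<bar>V k t x\<bar> \<le> B"
    and lip: "\<And>k s t x. 0 \<le> s \<Longrightarrow> 0 \<le> t \<Longrightarrow> x \<in> {0..1} \<Longrightarrow>
        \<bar>integral {0..x} (V k s) - integral {0..x} (V k t)\<bar> \<le> L * \<bar>s - t\<bar>"
    and L: "0 \<le> L"
  obtains u and r :: "nat \<Rightarrow> nat" where "strict_mono r"
    "\<And>t. 0 \<le> t \<Longrightarrow> antimono_on {0..1} (u t)"
    "\<And>t x. 0 \<le> t \<Longrightarrow> x \<in> {0..1} \<Longrightarrow> \<bar>u t x\<bar> \<le> B"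
    "\<And>t. 0 \<le> t \<Longrightarrow> \<exists>C. countable C \<and> (\<forall>x\<in>{0<..<1} - C. (\<lambda>k. V (r k) t x) \<longlonglongrightarrow> u t x)"
    "\<And>T e. 0 < e \<Longrightarrow> \<forall>\<^sub>F k in sequentially. \<forall>t\<in>{0..T}. L2_norm_unit (\<lambda>x. V (r k) t x - u t x) \<le> e"
    "C0_L2 u"
proof -
  have B: "0 \<le> B" using bnd[of 0 0] by fastforce
  define P where "P k t x = integral {0..x} (V k t)" for k t x
  have Plipx: "\<bar>P k t x - P k t y\<bar> \<le> B * \<bar>x - y\<bar>" if "0 \<le> t" "x \<in> {0..1}" "y \<in> {0..1}" for k t x y
  proof -
    have *: "\<bar>P k t y - P k t x\<bar> \<le> B * (y - x)" if xy: "x \<in> {0..1}" "y \<in> {0..1}" "x \<le> y" for x y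
    proof -
      have "V k t x * (y - x) \<le> B * (y - x)" "- B * (y - x) \<le> V k t y * (y - x)"
        using bnd[OF \<open>0 \<le> t\<close> xy(1), of k] bnd[OF \<open>0 \<le> t\<close> xy(2), of k] xy by (intro mult_right_mono; simp)+
      then show ?thesis
        using antimono_integral_bounds[OF mono[OF \<open>0 \<le> t\<close>], of x y k] xy unfolding P_def by auto
    qed
    show ?thesis using *[of x y] *[of y x] that by (cases "x \<le> y") (auto simp: abs_minus_commute)
  qed
  have P0: "P k t 0 = 0" for k t by (simp add: P_def)
  have PB: "\<bar>P k t x\<bar> \<le> B" if "0 \<le> t" "x \<in> {0..1}" for k t x
  proof -
    have "\<bar>P k t x\<bar> \<le> B * x" using Plipx[OF that(1), of x 0 k] that(2) by (simp add: P0)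
    also have "\<dots> \<le> B * 1" using that(2) B by (intro mult_left_mono) auto
    finally show ?thesis by simp
  qed
  define Q where "Q k z = fst z * P k (- ln (fst z)) (snd z)" for k and z :: "real \<times> real"
  define S :: "(real \<times> real) set" where "S = {0..1} \<times> {0..1}"
  have Qlip: "\<bar>Q k z - Q k w\<bar> \<le> (2 * B + L) * norm (z - w)" if "z \<in> S" "w \<in> S" for k z w
  proof -
    have a: "\<bar>Q k z - Q k w\<bar> \<le> (B + L) * \<bar>fst z - fst w\<bar> + B * \<bar>snd z - snd w\<bar>"
    proof (cases "fst z \<le> fst w")
      case True
      show ?thesis unfolding Q_def
        by (rule weighted_log_time_lipschitz[OF PB Plipx]) (use lip L that True in \<open>auto simp: S_def P_def\<close>)
    next
      case False
      have "\<bar>Q k w - Q k z\<bar> \<le> (B + L) * \<bar>fst w - fst z\<bar> + B * \<bar>snd w - snd z\<bar>"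
        unfolding Q_def
        by (rule weighted_log_time_lipschitz[OF PB Plipx]) (use lip L that False in \<open>auto simp: S_def P_def\<close>)
      then show ?thesis by (simp add: abs_minus_commute)
    qed
    have n: "\<bar>fst z - fst w\<bar> \<le> norm (z - w)" "\<bar>snd z - snd w\<bar> \<le> norm (z - w)"
      by (metis fst_diff norm_fst_le prod.collapse real_norm_def, metis snd_diff norm_snd_le prod.collapse real_norm_def)
    have "(B + L) * \<bar>fst z - fst w\<bar> + B * \<bar>snd z - snd w\<bar> \<le> (B + L) * norm (z - w) + B * norm (z - w)"
      using B L n by (intro add_mono mult_left_mono) auto
    with a show ?thesis by (simp add: algebra_simps)
  qed
  have "compact S" by (simp add: S_def compact_Times)
  moreover have "norm (Q k z) \<le> B" if "z \<in> S" for k z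
  proof (cases "fst z = 0")
    case False
    then have "\<bar>P k (- ln (fst z)) (snd z)\<bar> \<le> B" "\<bar>fst z\<bar> \<le> 1" using that by (auto simp: S_def intro!: PB)
    then show ?thesis unfolding Q_def using mult_mono[of "\<bar>fst z\<bar>" 1 "\<bar>P k (- ln (fst z)) (snd z)\<bar>" B]
      by (simp add: abs_mult)
  qed (use B in \<open>simp add: Q_def\<close>)
  moreover have "\<exists>d>0. \<forall>k y. y \<in> S \<and> norm (z - y) < d \<longrightarrow> norm (Q k z - Q k y) < e"
    if "z \<in> S" "0 < e" for z e
  proof (intro exI conjI allI impI)
    show "0 < e / (2 * B + L + 1)" using that B L by simp
    fix k y assume y: "y \<in> S \<and> norm (z - y) < e / (2 * B + L + 1)"
    have "norm (Q k z - Q k y) \<le> (2 * B + L) * norm (z - y)" using Qlip that y by simp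
    also have "\<dots> \<le> (2 * B + L + 1) * norm (z - y)" by (intro mult_right_mono) auto
    also have "\<dots> < e" using y B L by (simp add: field_simps)
    finally show "norm (Q k z - Q k y) < e" .
  qed
  ultimately obtain g and r :: "nat \<Rightarrow> nat" where r: "strict_mono r"
    and unif: "\<And>e. 0 < e \<Longrightarrow> \<exists>N. \<forall>n x. n \<ge> N \<and> x \<in> S \<longrightarrow> norm (Q (r n) x - g x) < e"
    using Arzela_Ascoli[of S Q B] by metis
  define Pl where "Pl t x = exp t * g (exp (- t), x)" for t x
  have Punif: "\<forall>\<^sub>F k in sequentially. \<forall>t\<in>{0..T}. \<forall>x\<in>{0..1}. \<bar>P (r k) t x - Pl t x\<bar> \<le> e"
    if "0 < e" for T e
  proof -
    obtain N where N: "\<And>n x. n \<ge> N \<Longrightarrow> x \<in> S \<Longrightarrow> norm (Q (r n) x - g x) < e * exp (- T)"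
      using unif[of "e * exp (- T)"] \<open>0 < e\<close> by auto
    have "\<bar>P (r k) t x - Pl t x\<bar> \<le> e" if k: "k \<ge> N" and t: "t \<in> {0..T}" and x: "x \<in> {0..1}" for k t x
    proof -
      have "P (r k) t x - Pl t x = exp t * (Q (r k) (exp (- t), x) - g (exp (- t), x))"
        by (simp add: Q_def Pl_def algebra_simps flip: mult.assoc exp_add)
      then have "\<bar>P (r k) t x - Pl t x\<bar> = exp t * \<bar>Q (r k) (exp (- t), x) - g (exp (- t), x)\<bar>"
        by (simp add: abs_mult)
      also have "\<dots> \<le> exp T * (e * exp (- T))"
        using N[OF k, of "(exp (- t), x)"] t x by (intro mult_mono) (auto simp: S_def)
      also have "\<dots> = e" by (simp add: exp_minus)
      finally show ?thesis .
    qed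
    then show ?thesis unfolding eventually_sequentially by blast
  qed
  have Pconv: "(\<lambda>k. P (r k) t x) \<longlonglongrightarrow> Pl t x" if "0 \<le> t" "x \<in> {0..1}" for t x
  proof (rule tendstoI)
    fix e :: real assume "0 < e"
    then have "\<forall>\<^sub>F k in sequentially. \<forall>s\<in>{0..t}. \<forall>x\<in>{0..1}. \<bar>P (r k) s x - Pl s x\<bar> \<le> e / 2"
      by (intro Punif) simp
    then show "\<forall>\<^sub>F k in sequentially. dist (P (r k) t x) (Pl t x) < e"
    proof eventually_elim
      case (elim k)
      then have "\<bar>P (r k) t x - Pl t x\<bar> \<le> e / 2" using that by simp
      then show ?case using \<open>0 < e\<close> by (simp add: dist_real_def)
    qed
  qed
  define good where "good t g \<longleftrightarrow> antimono_on {0..1} g \<and> (\<forall>x\<in>{0..1}. \<bar>g x\<bar> \<le> B) \<and>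
    (\<exists>C. countable C \<and> (\<forall>x\<in>{0<..<1} - C. (\<lambda>k. V (r k) t x) \<longlonglongrightarrow> g x)) \<and>
    (\<forall>x\<in>{0..1}. integral {0..x} g = Pl t x)" for t and g :: "real \<Rightarrow> real"
  define u where "u t = (SOME g. good t g)" for t
  have "good t (u t)" if "0 \<le> t" for t
  proof -
    have "\<exists>g. good t g"
      using that mono bnd Pconv unfolding P_def good_def by (intro antimono_limit_of_primitives) auto
    then show ?thesis unfolding u_def by (rule someI_ex)
  qed
  then have u: "\<And>t. 0 \<le> t \<Longrightarrow> antimono_on {0..1} (u t)"
    "\<And>t x. 0 \<le> t \<Longrightarrow> x \<in> {0..1} \<Longrightarrow> \<bar>u t x\<bar> \<le> B"
    "\<And>t. 0 \<le> t \<Longrightarrow> \<exists>C. countable C \<and> (\<forall>x\<in>{0<..<1} - C. (\<lambda>k. V (r k) t x) \<longlonglongrightarrow> u t x)"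
    "\<And>t x. 0 \<le> t \<Longrightarrow> x \<in> {0..1} \<Longrightarrow> integral {0..x} (u t) = Pl t x"
    unfolding good_def by blast+
  show ?thesis
  proof (rule that[OF r u(1-3)])
    show "\<forall>\<^sub>F k in sequentially. \<forall>t\<in>{0..T}. L2_norm_unit (\<lambda>x. V (r k) t x - u t x) \<le> e"
      if e: "0 < e" for T e
    proof -
      define \<delta> where "\<delta> = e\<^sup>2 / (6 * B + 1)"
      have \<delta>: "0 < \<delta>" using e B by (simp add: \<delta>_def)
      have "6 * B * \<delta> \<le> (6 * B + 1) * \<delta>" using \<delta> by (simp add: algebra_simps)
      also have "\<dots> = e\<^sup>2" using B by (simp add: \<delta>_def)
      finally have le: "sqrt (6 * B * \<delta>) \<le> e" using e by (simp add: real_le_lsqrt)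
      from Punif[OF \<delta>, of T] show ?thesis
      proof eventually_elim
        case (elim k)
        show ?case
        proof
          fix t assume t: "t \<in> {0..T}"
          have "L2_norm_unit (\<lambda>x. V (r k) t x - u t x) \<le> sqrt (6 * B * \<delta>)"
            by (rule antimono_L2_dist_le) (use t mono bnd u elim in \<open>auto simp: P_def\<close>)
          then show "L2_norm_unit (\<lambda>x. V (r k) t x - u t x) \<le> e" using le by simp
        qed
      qed
    qed
    have Pllip: "\<bar>Pl s x - Pl t x\<bar> \<le> L * \<bar>s - t\<bar>" if "0 \<le> s" "0 \<le> t" "x \<in> {0..1}" for s t x
      by (rule LIMSEQ_le_const2[of "\<lambda>k. \<bar>P (r k) s x - P (r k) t x\<bar>"])
         (use that lip[folded P_def] in \<open>auto intro!: tendsto_intros Pconv\<close>)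
    have ucont: "L2_norm_unit (\<lambda>x. u s x - u t x) \<le> sqrt (6 * B * (L * \<bar>s - t\<bar>))" if "0 \<le> s" "0 \<le> t" for s t
      by (rule antimono_L2_dist_le) (use that u Pllip in auto)
    show "C0_L2 u"
      unfolding C0_L2_def
    proof (intro conjI allI impI)
      fix t :: real assume t: "0 \<le> t"
      show "u t \<in> L2_unit"
        by (rule bounded_in_L2_unit(1)[of _ B]) (use t u in \<open>auto intro: antimono_on_unit_measurable\<close>)
      have "((\<lambda>s. sqrt (6 * B * (L * \<bar>s - t\<bar>))) \<longlongrightarrow> sqrt (6 * B * (L * \<bar>t - t\<bar>))) (at t within {0..})"
        by (intro tendsto_intros)
      then have lim: "((\<lambda>s. sqrt (6 * B * (L * \<bar>s - t\<bar>))) \<longlongrightarrow> 0) (at t within {0..})" by simp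
      show "((\<lambda>s. L2_norm_unit (\<lambda>x. u s x - u t x)) \<longlongrightarrow> 0) (at t within {0..})"
        by (rule tendsto_sandwich[OF _ _ tendsto_const lim])
           (use ucont t in \<open>auto simp: L2_norm_unit_def eventually_at_filter intro!: always_eventually\<close>)
    qed
  qed
qed

section \<open>The flux function\<close>

text \<open>What the construction uses of \<open>p = \<phi>'\<close>: the interval \<open>[- sb, sb]\<close> is a neighbourhood of the
origin where the equation is uniformly parabolic, with ellipticity constant \<open>\<kappa>\<close>.\<close>
locale pm_flux =
  fixes p :: "real \<Rightarrow> real" and \<kappa> sb Lp Mp :: real
  assumes odd: "p (- s) = - p s"
    and lip: "\<bar>p s - p r\<bar> \<le> Lp * \<bar>s - r\<bar>"
    and nonneg: "0 \<le> s \<Longrightarrow> 0 \<le> p s"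
    and bdd: "\<bar>p s\<bar> \<le> Mp"
    and steep: "\<lbrakk>- sb \<le> r; r \<le> s; s \<le> sb\<rbrakk> \<Longrightarrow> \<kappa> * (s - r) \<le> p s - p r"
    and sb: "0 < sb" and \<kappa>: "0 < \<kappa>"
    and vanish: "(p \<longlongrightarrow> 0) at_top"
begin

lemma zero [simp]: "p 0 = 0"
  using odd[of 0] by simp

lemma Lp: "0 \<le> Lp"
  using lip[of 1 0] abs_ge_zero[of "p 1 - p 0"] by simp

end

text \<open>Past its maximum point the derivative of \<open>\<phi>\<close> decreases to its limit \<open>0\<close>, so it is nonnegative there;
near the origin the second derivative exceeds half of its value at \<open>0\<close>, by continuity.\<close>
lemma pm_potential_flux:
  assumes "pm_potential \<phi>"
  obtains \<kappa> sb Lp Mp where "pm_flux (deriv \<phi>) \<kappa> sb Lp Mp"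
proof -
  let ?p = "deriv \<phi>" and ?p' = "deriv (deriv \<phi>)"
  from assms have even: "\<phi> (- x) = \<phi> x"
    and d1: "(\<phi> has_real_derivative ?p x) (at x)"
    and d2: "(?p has_real_derivative ?p' x) (at x)"
    and cont: "continuous_on UNIV ?p'" and bd: "bounded (range ?p')" and pos: "?p' 0 > 0"
    and lim: "(?p \<longlongrightarrow> 0) at_top" for x
    unfolding pm_potential_def by blast+
  from assms obtain \<sigma> where \<sigma>: "0 < \<sigma>" "mono_on {0..\<sigma>} ?p" "antimono_on {\<sigma>..} ?p"
    unfolding pm_potential_def by blast
  obtain K where K: "\<And>x. \<bar>?p' x\<bar> \<le> K" using bd by (auto simp: bounded_iff)
  have odd: "?p (- x) = - ?p x" for x
  proof -
    have "((\<lambda>x. \<phi> (- x)) has_real_derivative ?p (- x) * (- 1)) (at x)"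
      by (rule DERIV_chain'[where f = uminus, OF _ d1]) (auto intro!: derivative_eq_intros)
    then have "(\<phi> has_real_derivative - ?p (- x)) (at x)" by (simp add: even)
    then show ?thesis using DERIV_unique[OF d1] by fastforce
  qed
  have p0: "?p 0 = 0" using odd[of 0] by simp
  have nonneg: "0 \<le> ?p s" if "0 \<le> s" for s
  proof (cases "s \<le> \<sigma>")
    case True
    then have "?p 0 \<le> ?p s" using \<sigma> that by (intro mono_onD[OF \<sigma>(2)]) auto
    then show ?thesis by (simp add: p0)
  next
    case False
    have "\<forall>\<^sub>F r in at_top. ?p r \<le> ?p s"
      using eventually_ge_at_top[of s] by eventually_elim (use False \<sigma>(3) in \<open>auto simp: monotone_on_def\<close>)
    then show ?thesis using lim by (intro tendsto_upperbound[OF lim]) auto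
  qed
  have le: "?p s \<le> ?p \<sigma>" if "0 \<le> s" for s
    using \<sigma> that by (cases "s \<le> \<sigma>") (auto simp: monotone_on_def)
  have bdd: "\<bar>?p s\<bar> \<le> ?p \<sigma>" for s
    using nonneg[of s] le[of s] nonneg[of "- s"] le[of "- s"] odd[of s] by (cases "0 \<le> s") auto
  have lip: "\<bar>?p s - ?p r\<bar> \<le> K * \<bar>s - r\<bar>" for s r
    using field_differentiable_bound[of UNIV ?p ?p' K s r] d2 K by simp
  have "(?p' \<longlongrightarrow> ?p' 0) (at 0)" using cont by (simp add: continuous_on_def)
  then have "\<forall>\<^sub>F s in at 0. ?p' 0 / 2 < ?p' s" using pos by (intro order_tendstoD) auto
  then obtain d where d: "0 < d" "\<And>s. s \<noteq> 0 \<Longrightarrow> dist s 0 < d \<Longrightarrow> ?p' 0 / 2 < ?p' s"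
    unfolding eventually_at by blast
  have steep: "?p' 0 / 2 * (s - r) \<le> ?p s - ?p r" if "- (d / 2) \<le> r" "r \<le> s" "s \<le> d / 2" for r s
  proof (cases "r = s")
    case False
    then have "r < s" using that by simp
    then obtain z where z: "r < z" "z < s" "?p s - ?p r = (s - r) * ?p' z"
      using MVT2[of r s ?p ?p'] d2 by blast
    have "dist z 0 < d" using z that d(1) unfolding dist_real_def by linarith
    then have "?p' 0 / 2 \<le> ?p' z" using d(2)[of z] pos by (cases "z = 0") auto
    then show ?thesis unfolding z(3) using that by (subst mult.commute) (intro mult_left_mono, auto)
  qed simp
  have "pm_flux ?p (?p' 0 / 2) (d / 2) K (?p \<sigma>)"
    using odd lip nonneg bdd steep d(1) pos lim by unfold_locales auto
  then show ?thesis by (rule that)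
qed


section \<open>The modified system on the left half of the grid\<close>

text \<open>The grid has \<open>n = 2 N\<close> points, and only the points \<open>1, ..., N\<close> are unknowns. The plateau occupies
\<open>1, ..., m\<close> and starts at height \<open>A\<close>. Slopes of modulus at least \<open>\<Sigma>\<close> carry a flux of at most \<open>f\<close>, and
\<open>2 * b\<close> will bound the slopes on all edges other than the plateau edge \<open>m\<close>.\<close>
locale half_chain = pm_flux +
  fixes N m :: nat and b f \<Sigma> A :: real
  assumes m: "1 \<le> m" "m < N"
    and b: "0 < b" "2 * b \<le> sb"
    and f: "0 \<le> f" "f \<le> p (2 * b)"
    and \<Sigma>: "0 \<le> \<Sigma>" "\<And>s. \<Sigma> \<le> s \<Longrightarrow> p s \<le> f"
begin

text \<open>Freezing \<open>p\<close> outside \<open>[- sb, sb]\<close> makes it monotone on the whole line, which is what the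
comparison arguments need.\<close>
definition g :: "real \<Rightarrow> real" where "g s = p (max (- sb) (min sb s))"

text \<open>The flux through the plateau edge, frozen for slopes above \<open>- \<Sigma>\<close>, so that its modulus is at most
\<open>f\<close>; it agrees with \<open>p\<close> as long as the plateau stands out enough.\<close>
definition \<psi> :: "real \<Rightarrow> real" where "\<psi> s = p (min s (- \<Sigma>))"

abbreviation n :: real where "n \<equiv> 2 * real N"

text \<open>Edge \<open>j\<close> joins the points \<open>j\<close> and \<open>j + 1\<close>. Under odd reflection the neighbour of \<open>N\<close> has the
value \<open>- v N\<close>, whence the formula on the middle edge.\<close>
definition slope :: "(int \<Rightarrow> real) \<Rightarrow> int \<Rightarrow> real" where
  "slope v j = (if j = int N then - 2 * n * v j else n * (v (j + 1) - v j))"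

text \<open>Edge \<open>0\<close> carries the homogeneous Neumann condition.\<close>
definition flux :: "(int \<Rightarrow> real) \<Rightarrow> int \<Rightarrow> real" where
  "flux v j = (if j = 0 then 0 else if j = int m then \<psi> (slope v j) else g (slope v j))"

text \<open>A discrete form of the parabola \<open>b (1/4 - x\<^sup>2)\<close>, shifted by half a cell so that it vanishes at
\<open>N + 1\<close> and its slope on edge \<open>i\<close> is exactly \<open>- 2 b i / n\<close>.\<close>
definition w :: "int \<Rightarrow> real" where
  "w i = b * ((real N + i) * (real N + 1 - i)) / n\<^sup>2"

definition init :: "int \<Rightarrow> real" where
  "init i = (if i \<le> int m then A else w i)"

lemma N: "0 < N" "0 < n" using m by auto

lemma g_mono: "r \<le> s \<Longrightarrow> g r \<le> g s"
proof -
  assume "r \<le> s"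
  let ?c = "\<lambda>s. max (- sb) (min sb s)"
  have "\<kappa> * (?c s - ?c r) \<le> p (?c s) - p (?c r)"
    using sb \<open>r \<le> s\<close> by (intro steep) auto
  moreover have "0 \<le> \<kappa> * (?c s - ?c r)" using \<kappa> \<open>r \<le> s\<close> by auto
  ultimately show ?thesis by (simp add: g_def)
qed

lemma g_eq: "- sb \<le> s \<Longrightarrow> s \<le> sb \<Longrightarrow> g s = p s"
  by (simp add: g_def)

lemma g_zero: "g 0 = 0"
  using sb by (simp add: g_eq)

lemma g_lip: "\<bar>g s - g r\<bar> \<le> Lp * \<bar>s - r\<bar>"
proof -
  have "\<bar>g s - g r\<bar> \<le> Lp * \<bar>max (- sb) (min sb s) - max (- sb) (min sb r)\<bar>"
    unfolding g_def by (rule lip)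
  also have "\<dots> \<le> Lp * \<bar>s - r\<bar>" using Lp by (intro mult_left_mono) auto
  finally show ?thesis .
qed

lemma \<psi>_lip: "\<bar>\<psi> s - \<psi> r\<bar> \<le> Lp * \<bar>s - r\<bar>"
proof -
  have "\<bar>\<psi> s - \<psi> r\<bar> \<le> Lp * \<bar>min s (- \<Sigma>) - min r (- \<Sigma>)\<bar>"
    unfolding \<psi>_def by (rule lip)
  also have "\<dots> \<le> Lp * \<bar>s - r\<bar>" using Lp by (intro mult_left_mono) auto
  finally show ?thesis .
qed

lemma \<psi>_bounds: "- f \<le> \<psi> s" "\<psi> s \<le> 0"
proof -
  define q where "q = - min s (- \<Sigma>)"
  have q: "\<psi> s = - p q" "\<Sigma> \<le> q" "0 \<le> q"
    using odd[of q] \<Sigma>(1) by (auto simp: \<psi>_def q_def)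
  show "- f \<le> \<psi> s" "\<psi> s \<le> 0"
    using \<Sigma>(2)[OF q(2)] nonneg[OF q(3)] q(1) by auto
qed

lemma flux_lip:
  assumes "j \<in> {0..int N}"
  shows "\<bar>flux x j - flux y j\<bar> \<le> Lp * (2 * n * (\<Sum>i\<in>{1..int N}. \<bar>x i - y i\<bar>))"
proof (cases "j = 0")
  case True
  have "0 \<le> Lp * (2 * n * (\<Sum>i\<in>{1..int N}. \<bar>x i - y i\<bar>))"
    using Lp by (intro mult_nonneg_nonneg sum_nonneg) auto
  then show ?thesis using True by (simp add: flux_def)
next
  case False
  then have j: "1 \<le> j" "j \<le> int N" using assms by auto
  let ?S = "\<Sum>i\<in>{1..int N}. \<bar>x i - y i\<bar>"
  have mem: "\<bar>x i - y i\<bar> \<le> ?S" if "1 \<le> i" "i \<le> int N" for i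
    using that by (intro member_le_sum[of i "{1..int N}" "\<lambda>i. \<bar>x i - y i\<bar>"]) auto
  have "\<bar>slope x j - slope y j\<bar> \<le> 2 * n * ?S"
  proof (cases "j = int N")
    case True
    have "\<bar>slope x j - slope y j\<bar> = 2 * n * \<bar>x j - y j\<bar>"
      using True N by (simp add: slope_def abs_mult flip: right_diff_distrib)
    then show ?thesis using mem[OF j] by (auto intro!: mult_left_mono)
  next
    case False
    have "slope x j - slope y j = n * ((x (j + 1) - y (j + 1)) - (x j - y j))"
      using False by (simp add: slope_def algebra_simps)
    then have "\<bar>slope x j - slope y j\<bar> = n * \<bar>(x (j + 1) - y (j + 1)) - (x j - y j)\<bar>"
      by (simp add: abs_mult)
    also have "\<dots> \<le> n * (2 * ?S)"
      using mem[OF j] mem[of "j + 1"] j False by (intro mult_left_mono) auto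
    finally show ?thesis by simp
  qed
  then have *: "Lp * \<bar>slope x j - slope y j\<bar> \<le> Lp * (2 * n * ?S)"
    using Lp by (intro mult_left_mono)
  show ?thesis
    using False order_trans[OF g_lip *] order_trans[OF \<psi>_lip *] by (auto simp: flux_def)
qed

lemma half_chain_solution_exists:
  obtains V where "\<And>i. i \<in> {1..int N} \<Longrightarrow> V 0 i = init i"
    "\<And>i t. \<lbrakk>i \<in> {1..int N}; 0 \<le> t\<rbrakk> \<Longrightarrow>
      ((\<lambda>s. V s i) has_real_derivative n * (flux (V t) i - flux (V t) (i - 1))) (at t within {0..})"
proof (rule lipschitz_ode_exists[of "{1..int N}" "\<lambda>v i. n * (flux v i - flux v (i - 1))" "4 * n\<^sup>2 * Lp" init])
  fix i and x y :: "int \<Rightarrow> real" assume i: "i \<in> {1..int N}"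
  let ?S = "\<Sum>i\<in>{1..int N}. \<bar>x i - y i\<bar>"
  have "n * (flux x i - flux x (i - 1)) - n * (flux y i - flux y (i - 1))
    = n * ((flux x i - flux y i) - (flux x (i - 1) - flux y (i - 1)))" by (simp add: algebra_simps)
  also have "\<bar>\<dots>\<bar> \<le> n * (Lp * (2 * n * ?S) + Lp * (2 * n * ?S))"
    unfolding abs_mult
    by (intro mult_mono order_trans[OF abs_triangle_ineq4] add_mono flux_lip) (use i in auto)
  also have "\<dots> = 4 * n\<^sup>2 * Lp * ?S" by (simp add: power2_eq_square)
  finally show "\<bar>n * (flux x i - flux x (i - 1)) - n * (flux y i - flux y (i - 1))\<bar> \<le> 4 * n\<^sup>2 * Lp * ?S" .
qed (use Lp in auto)

lemma w_step: "n * (w (i + 1) - w i) = - 2 * b * i / n"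
  using N by (simp add: w_def divide_simps power2_eq_square) (simp add: algebra_simps)

lemma w_N: "w (int N) = b / n"
  using N by (simp add: w_def divide_simps power2_eq_square)

lemma w_le: "1 \<le> i \<Longrightarrow> w i \<le> b / 4 + b / (2 * n)"
proof -
  assume i: "1 \<le> i"
  have "0 \<le> real_of_int (i * (i - 1))" using i by (intro iffD2[OF of_int_0_le_iff] mult_nonneg_nonneg) auto
  then have "(real N + i) * (real N + 1 - i) \<le> real N * (real N + 1)" by (simp add: algebra_simps)
  then have "w i \<le> b * (real N * (real N + 1)) / n\<^sup>2"
    unfolding w_def using b by (intro divide_right_mono mult_left_mono) auto
  also have "\<dots> = b / 4 + b / (2 * n)" using N by (simp add: divide_simps power2_eq_square) (simp add: algebra_simps)
  finally show ?thesis .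
qed

lemma w_bounds:
  assumes "1 \<le> i" "i \<le> int N"
  shows "0 \<le> w i" "w i \<le> b"
proof -
  have i: "1 \<le> real_of_int i" "real_of_int i \<le> real N" using assms by linarith+
  show "0 \<le> w i" unfolding w_def using i b by (intro divide_nonneg_nonneg mult_nonneg_nonneg) auto
  have "(real N + i) * (real N + 1 - i) \<le> n * n" using i by (intro mult_mono) auto
  then have "b * ((real N + i) * (real N + 1 - i)) / n\<^sup>2 \<le> b * (n * n) / n\<^sup>2"
    using b by (intro divide_right_mono mult_left_mono) auto
  then show "w i \<le> b" using N by (simp add: w_def power2_eq_square)
qed

lemma w_ge: "b / 4 - b * (i / n)\<^sup>2 \<le> w i" if "1 \<le> i"
proof -
  have "0 \<le> b * (real N + i)" using b that by auto
  moreover have "w i = b / 4 - b * (i / n)\<^sup>2 + b * (real N + i) / n\<^sup>2"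
    using N by (simp add: w_def divide_simps power2_eq_square) (simp add: algebra_simps)
  ultimately show ?thesis by simp
qed

end

lemma sum_int_telescope:
  fixes F :: "int \<Rightarrow> real"
  shows "(\<Sum>i\<in>{1..int m}. F i - F (i - 1)) = F (int m) - F 0"
proof (induction m)
  case (Suc m)
  have "{1..int (Suc m)} = insert (int m + 1) {1..int m}" by auto
  then show ?case using Suc by (simp add: add.commute)
qed simp

lemma chain_le:
  fixes v :: "int \<Rightarrow> real"
  assumes "a \<le> d" "\<And>j. a \<le> j \<Longrightarrow> j < d \<Longrightarrow> v j \<le> v (j + 1) + c"
  shows "v a \<le> v d + c * (d - a)"
  using assms
proof (induction d rule: int_ge_induct)
  case (step d)
  have "v a \<le> v d + c * (d - a)" using step by auto
  also have "v d \<le> v (d + 1) + c" using step by auto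
  finally show ?case by (simp add: algebra_simps)
qed simp

text \<open>The first smallness condition on \<open>f\<close> says that the leakage through the plateau edge is at most
the flux of the decaying parabola at that edge. The second condition leaves a gap of slope \<open>\<Sigma>\<close>
between the sinking plateau and the highest possible value to its right.\<close>
locale half_chain_solution = half_chain +
  fixes V :: "real \<Rightarrow> int \<Rightarrow> real" and T :: real
  assumes V0: "i \<in> {1..int N} \<Longrightarrow> V 0 i = init i"
    and V': "\<lbrakk>i \<in> {1..int N}; 0 \<le> t\<rbrakk> \<Longrightarrow>
      ((\<lambda>s. V s i) has_real_derivative n * (flux (V t) i - flux (V t) (i - 1))) (at t within {0..})"
    and T: "0 < T" "f \<le> \<kappa> * exp (- 2 * \<kappa> * T) * (2 * b * m / n)"
    and gap: "\<Sigma> / n \<le> A - n * f * T / m - 2 * b * m / n - (b / 4 + b / (2 * n))"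
begin

lemma V'_Icc: "\<lbrakk>i \<in> {1..int N}; 0 \<le> t\<rbrakk> \<Longrightarrow>
      ((\<lambda>s. V s i) has_real_derivative n * (flux (V t) i - flux (V t) (i - 1))) (at t within {0..S})"
  by (rule has_field_derivative_subset[OF V']) auto

text \<open>Slopes are driven by the second difference of the flux. On the middle edge the two neighbouring
fluxes coincide by oddness.\<close>
definition slope' :: "real \<Rightarrow> int \<Rightarrow> real" where
  "slope' t j = n\<^sup>2 * (if j = int N then 2 * (flux (V t) (j - 1) - flux (V t) j)
     else flux (V t) (j + 1) - 2 * flux (V t) j + flux (V t) (j - 1))"

lemma slope_deriv:
  assumes "j \<in> {1..int N}" "0 \<le> t"
  shows "((\<lambda>s. slope (V s) j) has_real_derivative slope' t j) (at t within {0..S})"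
proof (cases "j = int N")
  case True
  then show ?thesis using DERIV_cmult[OF V'_Icc[OF assms], of "- 2 * n"]
    by (simp add: slope_def slope'_def power2_eq_square algebra_simps)
next
  case False
  then show ?thesis
    using DERIV_cmult[OF DERIV_diff[OF V'_Icc[of "j + 1" t S] V'_Icc[OF assms, of S]], of n] assms
    by (simp add: slope_def slope'_def power2_eq_square algebra_simps)
qed

lemma init_slope: "j \<in> {1..int N} - {int m} \<Longrightarrow> - 2 * b \<le> slope (V 0) j \<and> slope (V 0) j \<le> 0"
proof -
  assume j: "j \<in> {1..int N} - {int m}"
  consider "j < int m" | "int m < j" "j < int N" | "j = int N" using j by fastforce
  then show ?thesis
  proof cases
    case 1
    then show ?thesis using j V0[of j] V0[of "j + 1"] b m by (auto simp: slope_def init_def)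
  next
    case 2
    then have "slope (V 0) j = n * (w (j + 1) - w j)"
      using j V0[of j] V0[of "j + 1"] by (auto simp: slope_def init_def)
    also have "\<dots> = - 2 * b * (j / n)" by (simp add: w_step)
    finally have s: "slope (V 0) j = - 2 * b * (j / n)" .
    have "0 \<le> j / n" "j / n \<le> 1" using 2 N by (auto simp: divide_simps)
    then have "0 \<le> 2 * b * (j / n)" "2 * b * (j / n) \<le> 2 * b * 1"
      using b by (intro mult_nonneg_nonneg mult_left_mono; simp)+
    then show ?thesis unfolding s by simp
  next
    case 3
    have "slope (V 0) j = - 2 * n * (b / n)"
      using V0[of j] 3 m by (simp add: slope_def init_def w_N)
    then show ?thesis using N b by simp
  qed
qed

text \<open>At an edge whose slope is smallest and below \<open>- 2 * b\<close> the flux is smallest among all edges, the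
Neumann edge and the plateau edge included, since \<open>- f\<close> is not below the flux at slope \<open>- 2 * b\<close>.
The slope is driven by the second difference of the flux and so cannot decrease there.\<close>
lemma slope_ge:
  assumes j: "j \<in> {1..int N} - {int m}" and t: "0 \<le> t"
  shows "- 2 * b \<le> slope (V t) j"
proof -
  have "0 \<le> slope (V t) j + 2 * b"
  proof (rule finite_family_nonneg[where I = "{1..int N} - {int m}" and T = t and x = "\<lambda>j s. slope (V s) j + 2 * b"
      and x' = "\<lambda>j s. slope' s j"])
    show "((\<lambda>s. slope (V s) j + 2 * b) has_real_derivative slope' s j) (at s within {0..t})"
      if "j \<in> {1..int N} - {int m}" "0 \<le> s" "s \<le> t" for j s
      using DERIV_add[OF slope_deriv[of j s t] DERIV_const[of "2 * b"]] that by simp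
    show "0 \<le> slope (V 0) j + 2 * b" if "j \<in> {1..int N} - {int m}" for j
      using init_slope[OF that] by simp
    fix j s assume j: "j \<in> {1..int N} - {int m}" and neg: "slope (V s) j + 2 * b < 0"
      and least: "\<And>l. l \<in> {1..int N} - {int m} \<Longrightarrow> slope (V s) j + 2 * b \<le> slope (V s) l + 2 * b"
    have "g (slope (V s) j) \<le> g (- 2 * b)" using neg by (intro g_mono) auto
    also have "\<dots> = - p (2 * b)" using b odd[of "2 * b"] by (simp add: g_eq)
    finally have "g (slope (V s) j) \<le> - f" using f by simp
    moreover have "flux (V s) j = g (slope (V s) j)" using j by (auto simp: flux_def)
    ultimately have *: "flux (V s) j \<le> flux (V s) l" if "l \<in> {0..int N}" for l
      using that f \<psi>_bounds(1)[of "slope (V s) l"] least[of l] g_mono[of "slope (V s) j" "slope (V s) l"]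
      by (auto simp: flux_def)
    have "flux (V s) j \<le> flux (V s) (j - 1)" "j \<noteq> int N \<Longrightarrow> flux (V s) j \<le> flux (V s) (j + 1)"
      using * j by auto
    then show "0 \<le> slope' s j" unfolding slope'_def by (intro mult_nonneg_nonneg) auto
  qed (use j t in auto)
  then show ?thesis by simp
qed

text \<open>The mirror image of the preceding argument: a positive maximal slope has the largest flux.\<close>
lemma slope_le:
  assumes j: "j \<in> {1..int N} - {int m}" and t: "0 \<le> t"
  shows "slope (V t) j \<le> 0"
proof -
  have "0 \<le> - slope (V t) j"
  proof (rule finite_family_nonneg[where I = "{1..int N} - {int m}" and T = t and x = "\<lambda>j s. - slope (V s) j"
      and x' = "\<lambda>j s. - slope' s j"])
    show "((\<lambda>s. - slope (V s) j) has_real_derivative - slope' s j) (at s within {0..t})"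
      if "j \<in> {1..int N} - {int m}" "0 \<le> s" "s \<le> t" for j s
      using DERIV_minus[OF slope_deriv[of j s t]] that by simp
    show "0 \<le> - slope (V 0) j" if "j \<in> {1..int N} - {int m}" for j
      using init_slope[OF that] by simp
    fix j s assume j: "j \<in> {1..int N} - {int m}" and neg: "- slope (V s) j < 0"
      and least: "\<And>l. l \<in> {1..int N} - {int m} \<Longrightarrow> - slope (V s) j \<le> - slope (V s) l"
    have "0 \<le> g (slope (V s) j)" using neg g_mono[of 0 "slope (V s) j"] by (simp add: g_zero)
    moreover have "flux (V s) j = g (slope (V s) j)" using j by (auto simp: flux_def)
    ultimately have *: "flux (V s) l \<le> flux (V s) j" if "l \<in> {0..int N}" for l
      using that \<psi>_bounds(2)[of "slope (V s) l"] least[of l] g_mono[of "slope (V s) l" "slope (V s) j"]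
      by (auto simp: flux_def)
    have "flux (V s) (j - 1) \<le> flux (V s) j" "j \<noteq> int N \<Longrightarrow> flux (V s) (j + 1) \<le> flux (V s) j"
      using * j by auto
    then have "slope' s j \<le> 0" unfolding slope'_def by (intro mult_nonneg_nonpos) auto
    then show "0 \<le> - slope' s j" by simp
  qed (use j t in auto)
  then show ?thesis by simp
qed

text \<open>The barrier is concave in space: from one edge to the next its flux drops by at least
\<open>2 \<kappa> b / n\<close> times the exponential factor, which dominates its time derivative because \<open>w \<le> b\<close>. At the middle the
barrier satisfies the reflected condition as an inequality, and next to the plateau its own flux
is at least the leakage \<open>f\<close>.\<close>
lemma right_part_le:
  assumes i: "i \<in> {int m + 1..int N}" and t: "0 \<le> t" "t \<le> T"
  shows "V t i \<le> exp (- 2 * \<kappa> * t) * w i"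
proof -
  let ?E = "\<lambda>s. exp (- 2 * \<kappa> * s)"
  have "0 \<le> ?E t * w i - V t i"
  proof (rule finite_family_nonneg[where I = "{int m + 1..int N}" and T = T and x = "\<lambda>i s. ?E s * w i - V s i"
      and x' = "\<lambda>i s. - 2 * \<kappa> * (?E s * w i) - n * (flux (V s) i - flux (V s) (i - 1))"])
    show "((\<lambda>s. ?E s * w i - V s i) has_real_derivative
        - 2 * \<kappa> * (?E s * w i) - n * (flux (V s) i - flux (V s) (i - 1))) (at s within {0..T})"
      if "i \<in> {int m + 1..int N}" "0 \<le> s" "s \<le> T" for i s
      by (rule DERIV_diff[OF _ V'_Icc]) (use that in \<open>auto intro!: derivative_eq_intros\<close>)
    show "0 \<le> ?E 0 * w i - V 0 i" if "i \<in> {int m + 1..int N}" for i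
      using that V0[of i] by (simp add: init_def)
    fix i s assume i: "i \<in> {int m + 1..int N}" and s: "0 \<le> s" "s \<le> T"
      and neg: "?E s * w i - V s i < 0"
      and least: "\<And>j. j \<in> {int m + 1..int N} \<Longrightarrow> ?E s * w i - V s i \<le> ?E s * w j - V s j"
    define q where "q j = - (?E s * (2 * b * (j / n)))" for j :: int
    have E: "0 < ?E s" "?E s \<le> 1" using \<kappa> s by auto
    have q_eq: "q j = n * (?E s * w (j + 1) - ?E s * w j)" for j
    proof -
      have "n * (?E s * w (j + 1) - ?E s * w j) = ?E s * (n * (w (j + 1) - w j))"
        by (simp add: algebra_simps)
      also have "\<dots> = q j" unfolding w_step by (simp add: q_def)
      finally show ?thesis by simp
    qed
    have qb: "- sb \<le> q j" "q j \<le> 0" if "0 \<le> j" "j \<le> int N" for j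
    proof -
      have "\<exists>r. q j = - (?E s * (2 * b * r)) \<and> 0 \<le> r \<and> r \<le> 1"
        using that N unfolding q_def by (intro exI[of _ "j / n"]) (auto simp: divide_simps)
      then obtain r where r: "q j = - (?E s * (2 * b * r))" "0 \<le> r" "r \<le> 1" by blast
      have "?E s * (2 * b * r) \<le> 1 * (2 * b * 1)"
        using E b r by (intro mult_mono mult_left_mono) auto
      moreover have "0 \<le> ?E s * (2 * b * r)" using E b r by auto
      ultimately show "- sb \<le> q j" "q j \<le> 0" using b unfolding r(1) by linarith+
    qed
    have up: "flux (V s) i \<le> p (q i)"
    proof -
      have "slope (V s) i \<le> q i"
      proof (cases "i = int N")
        case True
        have "?E s * w i \<le> V s i" using neg by simp
        then have "slope (V s) i \<le> - 2 * n * (?E s * w i)" using True N by (simp add: slope_def)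
        also have "\<dots> = - 2 * b * ?E s" using True N by (simp add: w_N)
        also have "\<dots> \<le> q i" using True N b E by (simp add: q_def)
        finally show ?thesis .
      next
        case False
        then have "?E s * w i - V s i \<le> ?E s * w (i + 1) - V s (i + 1)" using i by (intro least) auto
        then have "n * (V s (i + 1) - V s i) \<le> n * (?E s * w (i + 1) - ?E s * w i)"
          using N by (intro mult_left_mono) auto
        then show ?thesis using False by (simp add: slope_def q_eq)
      qed
      then have "g (slope (V s) i) \<le> g (q i)" by (rule g_mono)
      also have "g (q i) = p (q i)" using qb[of i] i sb by (intro g_eq) auto
      finally show ?thesis using i by (simp add: flux_def)
    qed
    have down: "p (q (i - 1)) \<le> flux (V s) (i - 1)"
    proof (cases "i - 1 = int m")
      case True
      have "?E T \<le> ?E s" using s \<kappa> by simp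
      then have "f \<le> \<kappa> * ?E s * (2 * b * m / n)"
        using T(2) \<kappa> b N by (elim order_trans) (intro mult_right_mono mult_left_mono, auto)
      also have "\<dots> = \<kappa> * (0 - q (i - 1))" using True by (simp add: q_def)
      also have "\<dots> \<le> p 0 - p (q (i - 1))" using qb[of "i - 1"] i sb by (intro steep) auto
      finally have "p (q (i - 1)) \<le> - f" by simp
      also have "\<dots> \<le> \<psi> (slope (V s) (i - 1))" by (rule \<psi>_bounds)
      finally show ?thesis using True m by (simp add: flux_def)
    next
      case False
      then have "?E s * w i - V s i \<le> ?E s * w (i - 1) - V s (i - 1)" using i by (intro least) auto
      then have "n * (?E s * w i - ?E s * w (i - 1)) \<le> n * (V s i - V s (i - 1))"
        using N by (intro mult_left_mono) auto
      then have "q (i - 1) \<le> slope (V s) (i - 1)" using i by (simp add: slope_def q_eq)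
      then have "g (q (i - 1)) \<le> g (slope (V s) (i - 1))" by (rule g_mono)
      also have "g (slope (V s) (i - 1)) = flux (V s) (i - 1)" using False i by (simp add: flux_def)
      also have "g (q (i - 1)) = p (q (i - 1))" using qb[of "i - 1"] i sb by (intro g_eq) auto
      finally show ?thesis .
    qed
    have qi: "q (i - 1) - q i = ?E s * (2 * b / n)"
      using N by (simp add: q_def field_simps)
    have "\<kappa> * (q (i - 1) - q i) \<le> p (q (i - 1)) - p (q i)"
    proof (rule steep)
      have "0 \<le> ?E s * (2 * b / n)" using E b by auto
      then show "q i \<le> q (i - 1)" unfolding qi[symmetric] by simp
    qed (use qb[of "i - 1"] qb[of i] i sb in auto)
    then have "n * (\<kappa> * (?E s * (2 * b / n))) \<le> n * (flux (V s) (i - 1) - flux (V s) i)"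
      using up down N unfolding qi by (intro mult_left_mono) auto
    then have "2 * \<kappa> * (?E s * b) \<le> - (n * (flux (V s) i - flux (V s) (i - 1)))"
      using N by (simp add: algebra_simps)
    moreover have "2 * \<kappa> * (?E s * w i) \<le> 2 * \<kappa> * (?E s * b)"
      using w_bounds(2)[of i] i E \<kappa> by (intro mult_left_mono) auto
    ultimately show "0 \<le> - 2 * \<kappa> * (?E s * w i) - n * (flux (V s) i - flux (V s) (i - 1))" by linarith
  qed (use i t in auto)
  then show ?thesis by simp
qed

text \<open>The sum over the plateau only loses what passes through the plateau edge, at most \<open>n * f\<close> per unit
of time; and the slope bound keeps the edge of the plateau close to its average.\<close>
lemma plateau_edge_ge:
  assumes t: "0 \<le> t"
  shows "A - n * f * t / m - 2 * b * m / n \<le> V t (int m)"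
proof -
  let ?S = "\<lambda>s. \<Sum>i\<in>{1..int m}. V s i"
  have "0 \<le> ?S t + n * f * t - m * A"
  proof (rule finite_family_nonneg[where I = "{()}" and T = t and x = "\<lambda>_ s. ?S s + n * f * s - m * A"
      and x' = "\<lambda>_ s. n * flux (V s) (int m) + n * f"])
    show "((\<lambda>s. ?S s + n * f * s - m * A) has_real_derivative n * flux (V s) (int m) + n * f) (at s within {0..t})"
      if "0 \<le> s" for s
    proof -
      have "(?S has_real_derivative (\<Sum>i\<in>{1..int m}. n * (flux (V s) i - flux (V s) (i - 1)))) (at s within {0..t})"
        using that m by (intro DERIV_sum V'_Icc) auto
      also have "(\<Sum>i\<in>{1..int m}. n * (flux (V s) i - flux (V s) (i - 1))) = n * flux (V s) (int m)"
        by (simp only: sum_int_telescope flip: sum_distrib_left) (simp add: flux_def)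
      finally have D: "(?S has_real_derivative n * flux (V s) (int m)) (at s within {0..t})" .
      show ?thesis
        using DERIV_diff[OF DERIV_add[OF D DERIV_cmult[OF DERIV_ident, of "n * f"]] DERIV_const[of "m * A"]] by simp
    qed
    show "0 \<le> ?S 0 + n * f * 0 - m * A"
      using m V0 by (simp add: init_def)
    show "0 \<le> n * flux (V s) (int m) + n * f" for s
      using \<psi>_bounds(1)[of "slope (V s) (int m)"] m N
      by (auto simp: flux_def simp flip: distrib_left intro!: mult_nonneg_nonneg)
  qed (use t in auto)
  moreover have "?S t \<le> (\<Sum>i\<in>{1..int m}. V t (int m) + 2 * b * m / n)"
  proof (rule sum_mono)
    fix i assume i: "i \<in> {1..int m}"
    have "V t i \<le> V t (int m) + (2 * b / n) * (int m - i)"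
    proof (rule chain_le)
      fix j assume j: "i \<le> j" "j < int m"
      then have "- 2 * b \<le> n * (V t (j + 1) - V t j)"
        using slope_ge[of j t] i m t by (simp add: slope_def)
      then show "V t j \<le> V t (j + 1) + 2 * b / n" using N by (simp add: field_simps)
    qed (use i in auto)
    also have "\<dots> \<le> V t (int m) + (2 * b / n) * m"
      using i b N by (intro add_left_mono mult_left_mono) auto
    finally show "V t i \<le> V t (int m) + 2 * b * m / n" by simp
  qed
  ultimately have "m * A \<le> m * (V t (int m) + 2 * b * m / n) + n * f * t" by simp
  then show ?thesis using m by (simp add: field_simps)
qed

lemma interface_gap:
  assumes t: "0 \<le> t" "t \<le> T"
  shows "slope (V t) (int m) \<le> - \<Sigma>"
proof -
  have "n * f * t / m \<le> n * f * T / m"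
    using t f N m by (intro divide_right_mono mult_left_mono) auto
  then have "A - n * f * T / m - 2 * b * m / n \<le> V t (int m)" using plateau_edge_ge[OF t(1)] by linarith
  moreover have "V t (int m + 1) \<le> b / 4 + b / (2 * n)"
  proof -
    have "V t (int m + 1) \<le> exp (- 2 * \<kappa> * t) * w (int m + 1)" using m t by (intro right_part_le) auto
    also have "\<dots> \<le> 1 * w (int m + 1)"
      using m \<kappa> t w_bounds(1)[of "int m + 1"] by (intro mult_right_mono) auto
    also have "\<dots> \<le> b / 4 + b / (2 * n)" using w_le[of "int m + 1"] m by simp
    finally show ?thesis .
  qed
  ultimately have "\<Sigma> / n \<le> V t (int m) - V t (int m + 1)" using gap by linarith
  then have "\<Sigma> \<le> n * (V t (int m) - V t (int m + 1))" using N by (simp add: field_simps)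
  then show ?thesis using m by (simp add: slope_def algebra_simps)
qed

text \<open>The gap keeps the slope of the plateau edge below \<open>- \<Sigma>\<close>, and the other slopes stay in \<open>[- 2 b, 0]\<close>;
so \<open>g\<close> and \<open>\<psi>\<close> are evaluated only where they agree with \<open>p\<close>, and \<open>V\<close> solves the original system.\<close>
lemma flux_eq:
  assumes t: "0 \<le> t" "t \<le> T" and j: "j \<in> {1..int N}"
  shows "flux (V t) j = p (slope (V t) j)"
proof (cases "j = int m")
  case True
  then show ?thesis using interface_gap[OF t] m by (simp add: flux_def \<psi>_def)
next
  case False
  then have "g (slope (V t) j) = p (slope (V t) j)"
    using slope_ge[of j t] slope_le[of j t] b sb j t by (intro g_eq) auto
  then show ?thesis using False j by (simp add: flux_def)
qed

lemma slope_nonpos: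
  assumes t: "0 \<le> t" "t \<le> T" and j: "j \<in> {1..int N}"
  shows "slope (V t) j \<le> 0"
  using interface_gap[OF t] \<Sigma>(1) slope_le[of j t] t j by (cases "j = int m") auto

lemma V_decreasing:
  assumes t: "0 \<le> t" "t \<le> T" and j: "1 \<le> j" "j < int N"
  shows "V t (j + 1) \<le> V t j"
  using slope_nonpos[OF t, of j] j N by (simp add: slope_def mult_le_0_iff)

lemma V_last_nonneg:
  assumes t: "0 \<le> t" "t \<le> T"
  shows "0 \<le> V t (int N)"
  using slope_nonpos[OF t, of "int N"] m N by (simp add: slope_def zero_le_mult_iff)

lemma V_nonneg:
  assumes t: "0 \<le> t" "t \<le> T" and i: "i \<in> {1..int N}"
  shows "0 \<le> V t i"
proof -
  have "V t (int N) \<le> V t i"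
    using chain_le[of i "int N" "\<lambda>j. - V t j" 0] V_decreasing[OF t] i by simp
  then show ?thesis using V_last_nonneg[OF t] by simp
qed

lemma flux_nonpos:
  assumes j: "j \<in> {0..int N}" and t: "0 \<le> t"
  shows "flux (V t) j \<le> 0"
proof (cases "j = 0 \<or> j = int m")
  case True
  then show ?thesis using \<psi>_bounds(2) by (auto simp: flux_def)
next
  case False
  then show ?thesis using g_mono[OF slope_le[of j t]] j t by (simp add: flux_def g_zero)
qed

lemma V_first_le:
  assumes t: "0 \<le> t" "t \<le> T"
  shows "V t 1 \<le> A"
proof -
  have "0 \<le> A - V t 1"
  proof (rule finite_family_nonneg[where I = "{()}" and T = T and x = "\<lambda>_ s. A - V s 1"
      and x' = "\<lambda>_ s. - (n * (flux (V s) 1 - flux (V s) (1 - 1)))"])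
    show "((\<lambda>s. A - V s 1) has_real_derivative - (n * (flux (V s) 1 - flux (V s) (1 - 1)))) (at s within {0..T})"
      if "0 \<le> s" for s
      using DERIV_diff[OF DERIV_const V'_Icc[of 1 s T], of A] that m by simp
    show "0 \<le> A - V 0 1" using V0[of 1] m by (simp add: init_def)
    show "0 \<le> - (n * (flux (V s) 1 - flux (V s) (1 - 1)))" if "0 \<le> s" "s \<le> T" for s
    proof -
      have "flux (V s) 1 \<le> 0" using flux_nonpos[of 1 s] that m by simp
      then show ?thesis using N by (simp add: flux_def mult_le_0_iff)
    qed
  qed (use t in auto)
  then show ?thesis by simp
qed

lemma V_first_ge:
  assumes t: "0 \<le> t" "t \<le> T"
  shows "A - n * f * T / m - 2 * b * m / n \<le> V t 1"
proof -
  have "n * f * t / m \<le> n * f * T / m"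
    using t f N m by (intro divide_right_mono mult_left_mono) auto
  then have "A - n * f * T / m - 2 * b * m / n \<le> V t (int m)" using plateau_edge_ge[OF t(1)] by linarith
  also have "V t (int m) \<le> V t 1"
    using chain_le[of 1 "int m" "\<lambda>j. - V t j" 0] m V_decreasing[OF t] by simp
  finally show ?thesis .
qed

end

section \<open>Odd reflection and continuation in time\<close>

definition reflect :: "nat \<Rightarrow> (int \<Rightarrow> real) \<Rightarrow> int \<Rightarrow> real" where
  "reflect N v i = (if i \<le> int N then v i else - v (2 * int N + 1 - i))"

context half_chain_solution
begin

text \<open>Edges \<open>j\<close> and \<open>2 * N - j\<close> have equal slopes by oddness, so the reflected function solves the
equation on the whole grid.\<close>
lemma reflect_flux:
  assumes t: "0 \<le> t" "t \<le> T" and j: "j \<in> {0..2 * int N}"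
  shows "p (Dplus (2 * N) (neumann_ext (2 * N) (reflect N (V t))) j)
    = flux (V t) (if j \<le> int N then j else 2 * int N - j)"
proof -
  consider "j = 0" | "1 \<le> j" "j < int N" | "j = int N" | "int N < j" "j < 2 * int N" | "j = 2 * int N"
    using j by fastforce
  then show ?thesis
  proof cases
    case 1
    then show ?thesis using m by (simp add: Dplus_def neumann_ext_def flux_def)
  next
    case 2
    then have "Dplus (2 * N) (neumann_ext (2 * N) (reflect N (V t))) j = slope (V t) j"
      by (simp add: Dplus_def neumann_ext_def reflect_def slope_def)
    then show ?thesis using 2 flux_eq[OF t, of j] by simp
  next
    case 3
    then have "Dplus (2 * N) (neumann_ext (2 * N) (reflect N (V t))) j = slope (V t) j"
      using m by (simp add: Dplus_def neumann_ext_def reflect_def slope_def)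
    then show ?thesis using 3 m flux_eq[OF t, of j] by simp
  next
    case 4
    then have "Dplus (2 * N) (neumann_ext (2 * N) (reflect N (V t))) j = slope (V t) (2 * int N - j)"
      by (simp add: Dplus_def neumann_ext_def reflect_def slope_def algebra_simps)
    then show ?thesis using 4 flux_eq[OF t, of "2 * int N - j"] by simp
  next
    case 5
    then show ?thesis using m by (simp add: Dplus_def neumann_ext_def flux_def)
  qed
qed

lemma reflect_solves:
  assumes t: "0 \<le> t" "t \<le> T" and i: "i \<in> {1..2 * int N}"
  shows "((\<lambda>s. reflect N (V s) i) has_real_derivative
     Dminus (2 * N) (\<lambda>j. p (Dplus (2 * N) (neumann_ext (2 * N) (reflect N (V t))) j)) i) (at t within {0..})"
proof (cases "i \<le> int N")
  case True
  then show ?thesis using V'[of i t] i t reflect_flux[OF t, of i] reflect_flux[OF t, of "i - 1"]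
    by (simp add: Dminus_def reflect_def)
next
  case False
  let ?k = "2 * int N + 1 - i"
  have "((\<lambda>s. - V s ?k) has_real_derivative - (n * (flux (V t) ?k - flux (V t) (?k - 1)))) (at t within {0..})"
    using V'[of ?k t] i t False by (intro DERIV_minus) auto
  moreover have "p (Dplus (2 * N) (neumann_ext (2 * N) (reflect N (V t))) i) = flux (V t) (?k - 1)"
    using reflect_flux[OF t, of i] i False by simp
  moreover have "p (Dplus (2 * N) (neumann_ext (2 * N) (reflect N (V t))) (i - 1)) = flux (V t) ?k"
  proof (cases "i - 1 = int N")
    case True
    then have "i = int N + 1" by simp
    then show ?thesis using reflect_flux[OF t, of "i - 1"] i by simp
  next
    case False
    have "2 * int N - (i - 1) = ?k" by simp
    then show ?thesis using reflect_flux[OF t, of "i - 1"] i False \<open>\<not> i \<le> int N\<close> by (simp only:) simp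
  qed
  ultimately show ?thesis using False by (simp add: Dminus_def reflect_def algebra_simps)
qed

lemma reflect_decreasing:
  assumes t: "0 \<le> t" "t \<le> T" and i: "i \<in> {1..<2 * int N}"
  shows "reflect N (V t) (i + 1) \<le> reflect N (V t) i"
proof -
  consider "i < int N" | "i = int N" | "int N < i" by linarith
  then show ?thesis
  proof cases
    case 1
    then show ?thesis using V_decreasing[OF t, of i] i by (simp add: reflect_def)
  next
    case 2
    then show ?thesis using V_last_nonneg[OF t] by (simp add: reflect_def)
  next
    case 3
    then have "V t (2 * int N - i + 1) \<le> V t (2 * int N - i)" using i by (intro V_decreasing[OF t]) auto
    then show ?thesis using 3 by (simp add: reflect_def algebra_simps)
  qed
qed

end

context pm_flux
begin

definition semidiscrete :: "nat \<Rightarrow> (int \<Rightarrow> real) \<Rightarrow> int \<Rightarrow> real" where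
  "semidiscrete n v i = Dminus n (\<lambda>j. p (Dplus n (neumann_ext n v) j)) i"

lemma neumann_ext_in:
  assumes "0 < n" "i \<in> {0..int n + 1}"
  obtains j where "j \<in> {1..int n}" "\<And>v. neumann_ext n v i = v j"
proof -
  consider "i = 0" | "i = int n + 1" | "i \<in> {1..int n}" using assms by fastforce
  then show ?thesis
  proof cases
    case 1 then show ?thesis using assms by (intro that[of 1]) (auto simp: neumann_ext_def)
  next
    case 2 then show ?thesis using assms by (intro that[of "int n"]) (auto simp: neumann_ext_def)
  next
    case 3 then show ?thesis by (intro that[of i]) (auto simp: neumann_ext_def)
  qed
qed

lemma semidiscrete_lip:
  assumes i: "i \<in> {1..int n}"
  shows "\<bar>semidiscrete n x i - semidiscrete n y i\<bar> \<le> 4 * (real n)\<^sup>2 * Lp * (\<Sum>j\<in>{1..int n}. \<bar>x j - y j\<bar>)"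
proof -
  let ?S = "\<Sum>j\<in>{1..int n}. \<bar>x j - y j\<bar>" and ?D = "\<lambda>v j. Dplus n (neumann_ext n v) j"
  have n: "0 < n" using i by auto
  have ext: "\<bar>neumann_ext n x j - neumann_ext n y j\<bar> \<le> ?S" if "j \<in> {0..int n + 1}" for j
  proof -
    obtain l where l: "l \<in> {1..int n}" "\<And>v. neumann_ext n v j = v l"
      using neumann_ext_in[OF n \<open>j \<in> {0..int n + 1}\<close>] by blast
    then show ?thesis using member_le_sum[of l "{1..int n}" "\<lambda>j. \<bar>x j - y j\<bar>"] by simp
  qed
  have edge: "\<bar>p (?D x j) - p (?D y j)\<bar> \<le> Lp * (real n * (2 * ?S))" if j: "j \<in> {0..int n}" for j
  proof -
    have "?D x j - ?D y j = real n * ((neumann_ext n x (j + 1) - neumann_ext n y (j + 1))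
        - (neumann_ext n x j - neumann_ext n y j))"
      by (simp add: Dplus_def algebra_simps)
    then have "\<bar>?D x j - ?D y j\<bar> = real n * \<bar>(neumann_ext n x (j + 1) - neumann_ext n y (j + 1))
        - (neumann_ext n x j - neumann_ext n y j)\<bar>"
      by (simp add: abs_mult)
    also have "\<dots> \<le> real n * (2 * ?S)"
      using ext[of j] ext[of "j + 1"] j by (intro mult_left_mono) auto
    finally show ?thesis using lip[of "?D x j" "?D y j"] Lp by (meson mult_left_mono order_trans)
  qed
  have "semidiscrete n x i - semidiscrete n y i
      = real n * ((p (?D x i) - p (?D y i)) - (p (?D x (i - 1)) - p (?D y (i - 1))))"
    by (simp add: semidiscrete_def Dminus_def algebra_simps)
  also have "\<bar>\<dots>\<bar> \<le> real n * (Lp * (real n * (2 * ?S)) + Lp * (real n * (2 * ?S)))"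
    unfolding abs_mult
    by (intro mult_mono order_trans[OF abs_triangle_ineq4] add_mono edge) (use i in auto)
  also have "\<dots> = 4 * (real n)\<^sup>2 * Lp * ?S" by (simp add: power2_eq_square)
  finally show ?thesis .
qed

text \<open>Past time \<open>T\<close> any solution with the right value at \<open>T\<close> may be appended: both one-sided derivatives
at \<open>T\<close> are given by the equation itself.\<close>
lemma semidiscrete_extension:
  assumes T: "0 < T"
    and V: "\<And>t i. \<lbrakk>0 \<le> t; t \<le> T; i \<in> {1..int n}\<rbrakk> \<Longrightarrow>
      ((\<lambda>s. V s i) has_real_derivative semidiscrete n (V t) i) (at t within {0..})"
  obtains U where "\<And>t i. \<lbrakk>0 \<le> t; t \<le> T\<rbrakk> \<Longrightarrow> U t i = V t i"
    "\<And>t i. \<lbrakk>0 \<le> t; i \<in> {1..int n}\<rbrakk> \<Longrightarrow>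
      ((\<lambda>s. U s i) has_real_derivative semidiscrete n (U t) i) (at t within {0..})"
proof -
  obtain W where W: "\<And>i. i \<in> {1..int n} \<Longrightarrow> W 0 i = V T i"
    "\<And>i t. \<lbrakk>i \<in> {1..int n}; 0 \<le> t\<rbrakk> \<Longrightarrow>
      ((\<lambda>s. W s i) has_real_derivative semidiscrete n (W t) i) (at t within {0..})"
    by (rule lipschitz_ode_exists[of "{1..int n}" "semidiscrete n" "4 * (real n)\<^sup>2 * Lp" "V T"])
       (use semidiscrete_lip Lp in auto)
  have cong: "semidiscrete n x i = semidiscrete n y i"
    if "i \<in> {1..int n}" "\<And>j. j \<in> {1..int n} \<Longrightarrow> x j = y j" for x y i
    using semidiscrete_lip[OF that(1), of x y] that(2) by simp
  define U where "U t i = (if t \<in> {0..T} then V t i else W (t - T) i)" for t i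
  have "((\<lambda>s. U s i) has_real_derivative semidiscrete n (U t) i) (at t within {0..})"
    if t: "0 \<le> t" and i: "i \<in> {1..int n}" for t i
  proof -
    have "((\<lambda>s. if s \<in> {0..T} then V s i else W (s - T) i) has_vector_derivative
       (if t \<in> {0..T} then semidiscrete n (V t) i else semidiscrete n (W (t - T)) i)) (at t within {0..})"
    proof (rule has_vector_derivative_If_within_closures)
      show "t \<in> {0..T} \<union> {T..}" "{0..} = {0..T} \<union> {T..}" using t T by auto
      have un: "{0..T} \<union> closure {0..T} \<inter> closure {T..} = {0..T}"
        "{T..} \<union> closure {0..T} \<inter> closure {T..} = {T..}" using T by auto
      show "((\<lambda>s. V s i) has_vector_derivative semidiscrete n (V t) i)
          (at t within {0..T} \<union> closure {0..T} \<inter> closure {T..})"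
        if "t \<in> {0..T} \<union> closure {0..T} \<inter> closure {T..}"
        using that unfolding un has_real_derivative_iff_has_vector_derivative[symmetric]
        by (intro has_field_derivative_subset[OF V[OF _ _ i]]) auto
      show "((\<lambda>s. W (s - T) i) has_vector_derivative semidiscrete n (W (t - T)) i)
          (at t within {T..} \<union> closure {0..T} \<inter> closure {T..})"
        if "t \<in> {T..} \<union> closure {0..T} \<inter> closure {T..}"
      proof -
        have "x \<in> (\<lambda>s. s - T) ` {T..}" if "0 \<le> x" for x
          using that by (intro image_eqI[of _ _ "x + T"]) auto
        then have im: "(\<lambda>s. s - T) ` {T..} = {0..}" by auto
        have "((\<lambda>s. W s i) \<circ> (\<lambda>s. s - T) has_real_derivative semidiscrete n (W (t - T)) i * 1) (at t within {T..})"
          by (rule DERIV_image_chain) (use that T W(2)[OF i] in \<open>auto simp: im un intro!: derivative_eq_intros\<close>)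
        then show ?thesis
          unfolding un has_real_derivative_iff_has_vector_derivative[symmetric] by (simp add: o_def)
      qed
      show "V t i = W (t - T) i" "semidiscrete n (V t) i = semidiscrete n (W (t - T)) i"
        if "t \<in> closure {0..T}" "t \<in> closure {T..}"
      proof -
        have "t = T" using that by auto
        then show "V t i = W (t - T) i" "semidiscrete n (V t) i = semidiscrete n (W (t - T)) i"
          using W(1) i by (auto intro!: cong[OF i])
      qed
    qed
    moreover have "semidiscrete n (U t) i = (if t \<in> {0..T} then semidiscrete n (V t) i else semidiscrete n (W (t - T)) i)"
      by (auto simp: U_def[abs_def])
    ultimately show ?thesis
      unfolding U_def has_real_derivative_iff_has_vector_derivative by simp
  qed
  then show ?thesis by (intro that[of U]) (auto simp: U_def)
qed

end

section \<open>Choice of the parameters\<close>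

context pm_flux
begin

text \<open>All properties of the approximations that survive the choice of parameters; indices
beyond \<open>\<epsilon> * n\<close> lie to the right of the plateau.\<close>
definition plateau_scheme :: "real \<Rightarrow> nat \<Rightarrow> real \<Rightarrow> real \<Rightarrow> (real \<Rightarrow> int \<Rightarrow> real) \<Rightarrow> bool" where
  "plateau_scheme b N \<epsilon> T U \<longleftrightarrow>
    (\<forall>t\<ge>0. \<forall>i\<in>{1..int (2 * N)}.
      ((\<lambda>s. U s i) has_real_derivative semidiscrete (2 * N) (U t) i) (at t within {0..})) \<and>
    (\<forall>t\<in>{0..T}.
      (\<forall>i\<in>{1..<2 * int N}. U t (i + 1) \<le> U t i) \<and>
      (\<forall>i\<in>{1..2 * int N}. U t (2 * int N + 1 - i) = - U t i) \<and>
      b / 4 \<le> U t 1 \<and> U t 1 \<le> b / 4 + 4 * \<epsilon> \<and>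
      (\<forall>i\<in>{1..2 * int N}. \<epsilon> * (2 * real N) < i \<longrightarrow> U t i \<le> exp (- 2 * \<kappa> * t) * (b / 4) + \<epsilon>)) \<and>
    (\<forall>i\<in>{1..int N}. b / 4 - b * (i / (2 * real N))\<^sup>2 \<le> U 0 i) \<and> U 0 1 = b / 4 + 4 * \<epsilon>"

text \<open>The order of choices is: the relative width \<open>\<rho>\<close> of the plateau, then the admissible leakage \<open>f\<close>,
small compared with \<open>\<rho>\<close>, then a slope \<open>\<Sigma>\<close> beyond which the flux is below \<open>f\<close>, and finally \<open>N\<close> so
large that a jump of slope \<open>\<Sigma>\<close> has negligible height.\<close>
lemma plateau_scheme_exists:
  assumes b: "0 < b" "2 * b \<le> sb" and \<epsilon>: "0 < \<epsilon>" and T: "0 < T"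
  shows "\<exists>N0. \<forall>N\<ge>N0. \<exists>U. plateau_scheme b N \<epsilon> T U"
proof -
  define \<rho> where "\<rho> = min (1/4) (min \<epsilon> (\<epsilon> / (2 * b)))"
  have \<rho>: "0 < \<rho>" "\<rho> \<le> 1/4" "\<rho> \<le> \<epsilon>" "\<rho> \<le> \<epsilon> / (2 * b)" using \<epsilon> b by (auto simp: \<rho>_def)
  \<comment> \<open>three demands on the leakage: slope bound, barrier next to the plateau, slow sinking up to time \<open>T\<close>\<close>
  define f where "f = min (p (2 * b)) (min (\<kappa> * exp (- 2 * \<kappa> * T) * (b * \<rho>)) (\<epsilon> * \<rho> / (2 * T)))"
  have "\<kappa> * (2 * b - 0) \<le> p (2 * b) - p 0" using b sb by (intro steep) auto
  moreover have "0 < \<kappa> * (2 * b - 0)" using \<kappa> b by simp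
  ultimately have "0 < p (2 * b)" by simp
  then have f: "0 < f" "f \<le> p (2 * b)" "f \<le> \<kappa> * exp (- 2 * \<kappa> * T) * (b * \<rho>)" "f \<le> \<epsilon> * \<rho> / (2 * T)"
    using \<kappa> b \<rho> \<epsilon> T by (auto simp: f_def)
  have "\<forall>\<^sub>F s in at_top. p s < f" using order_tendstoD(2)[OF vanish f(1)] .
  then obtain \<Sigma>0 where \<Sigma>0: "\<And>s. \<Sigma>0 \<le> s \<Longrightarrow> p s < f" unfolding eventually_at_top_linorder by blast
  define \<Sigma> where "\<Sigma> = max 0 \<Sigma>0"
  have \<Sigma>: "0 \<le> \<Sigma>" "\<And>s. \<Sigma> \<le> s \<Longrightarrow> p s \<le> f" using \<Sigma>0 by (auto simp: \<Sigma>_def intro: less_imp_le)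
  define N0 where "N0 = nat \<lceil>max (\<Sigma> / \<epsilon>) (max (b / \<epsilon>) (2 / \<rho>))\<rceil>"
  have "\<exists>U. plateau_scheme b N \<epsilon> T U" if "N \<ge> N0" for N
  proof -
    have "max (\<Sigma> / \<epsilon>) (max (b / \<epsilon>) (2 / \<rho>)) \<le> real N" using that unfolding N0_def by linarith
    then have large: "\<Sigma> / \<epsilon> \<le> real N" "b / \<epsilon> \<le> real N" "2 / \<rho> \<le> real N" by auto
    then have large': "\<Sigma> \<le> \<epsilon> * real N" "b \<le> \<epsilon> * real N" "2 \<le> \<rho> * real N"
      using \<epsilon> \<rho> by (simp_all add: field_simps)
    have Npos: "0 < real N" using large(3) \<rho>(1) by (smt (verit) divide_pos_pos)
    define m where "m = nat \<lfloor>\<rho> * (2 * real N)\<rfloor>"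
    have m_le: "real m \<le> \<rho> * (2 * real N)" and m_ge: "\<rho> * (2 * real N) - 1 < real m"
      using large'(3) by (auto simp: m_def)
    have m_ge': "\<rho> * real N \<le> real m" using m_ge large'(3) by linarith
    have "\<rho> * (2 * real N) \<le> 1/4 * (2 * real N)" using \<rho> Npos by (intro mult_right_mono) auto
    then have m: "1 \<le> m" "m < N" using m_le m_ge' large'(3) Npos by linarith+
    \<comment> \<open>an excess of \<open>4 * \<epsilon>\<close> pays for sinking, for the tilt of the plateau, for \<open>w \<le> b / 4 + \<epsilon>\<close> and for the jump\<close>
    define A where "A = b / 4 + 4 * \<epsilon>"
    interpret H: half_chain p \<kappa> sb Lp Mp N m b f \<Sigma> A
      using m b f \<Sigma> by unfold_locales auto
    obtain V where V: "\<And>i. i \<in> {1..int N} \<Longrightarrow> V 0 i = H.init i"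
      "\<And>i t. \<lbrakk>i \<in> {1..int N}; 0 \<le> t\<rbrakk> \<Longrightarrow>
        ((\<lambda>s. V s i) has_real_derivative H.n * (H.flux (V t) i - H.flux (V t) (i - 1))) (at t within {0..})"
      by (rule H.half_chain_solution_exists) blast
    have e1: "H.n * f * T / m \<le> \<epsilon>"
    proof -
      have "f * T * 2 \<le> \<epsilon> * \<rho>" using f(4) T by (simp add: field_simps)
      then have "f * T * 2 * real N \<le> \<epsilon> * \<rho> * real N" using Npos by (intro mult_right_mono) auto
      also have "\<dots> \<le> \<epsilon> * real m" using m_ge' \<epsilon> by (simp add: mult.assoc)
      finally show ?thesis using m by (simp add: field_simps)
    qed
    have e2: "2 * b * m / H.n \<le> \<epsilon>"
    proof -
      have "2 * b * real m \<le> 2 * b * (\<rho> * (2 * real N))" using m_le b by (intro mult_left_mono) auto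
      also have "\<dots> = (2 * b * \<rho>) * (2 * real N)" by simp
      also have "\<dots> \<le> \<epsilon> * (2 * real N)" using \<rho>(4) b Npos by (intro mult_right_mono) (auto simp: field_simps)
      finally show ?thesis using Npos by (simp add: field_simps)
    qed
    have e3: "b / (2 * H.n) \<le> \<epsilon>" "\<Sigma> / H.n \<le> \<epsilon>"
      using large' Npos \<epsilon> b \<Sigma>(1) by (auto simp: field_simps)
    have e4: "f \<le> \<kappa> * exp (- 2 * \<kappa> * T) * (2 * b * m / H.n)"
    proof -
      have "b * (\<rho> * real N) \<le> b * real m" using b m_ge' by (intro mult_left_mono) auto
      then have "b * \<rho> \<le> 2 * b * m / H.n" using Npos by (simp add: field_simps)
      then have "\<kappa> * exp (- 2 * \<kappa> * T) * (b * \<rho>) \<le> \<kappa> * exp (- 2 * \<kappa> * T) * (2 * b * m / H.n)"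
        using \<kappa> by (intro mult_left_mono) auto
      with f(3) show ?thesis by linarith
    qed
    interpret S: half_chain_solution p \<kappa> sb Lp Mp N m b f \<Sigma> A V T
    proof unfold_locales
      show "\<Sigma> / H.n \<le> A - H.n * f * T / m - 2 * b * m / H.n - (b / 4 + b / (2 * H.n))"
        using e1 e2 e3 unfolding A_def by linarith
    qed (fact V T e4)+
    obtain U where U: "\<And>t i. \<lbrakk>0 \<le> t; t \<le> T\<rbrakk> \<Longrightarrow> U t i = reflect N (V t) i"
      "\<And>t i. \<lbrakk>0 \<le> t; i \<in> {1..int (2 * N)}\<rbrakk> \<Longrightarrow>
        ((\<lambda>s. U s i) has_real_derivative semidiscrete (2 * N) (U t) i) (at t within {0..})"
    proof (rule semidiscrete_extension[of T "2 * N" "\<lambda>t. reflect N (V t)"])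
      show "((\<lambda>s. reflect N (V s) i) has_real_derivative semidiscrete (2 * N) (reflect N (V t)) i) (at t within {0..})"
        if "0 \<le> t" "t \<le> T" "i \<in> {1..int (2 * N)}" for t i
        using S.reflect_solves[of t i] that unfolding semidiscrete_def by simp
    qed (use T in auto)
    have "plateau_scheme b N \<epsilon> T U"
      unfolding plateau_scheme_def
    proof (intro conjI ballI allI impI)
      fix t :: real and i assume "0 \<le> t" "i \<in> {1..int (2 * N)}"
      then show "((\<lambda>s. U s i) has_real_derivative semidiscrete (2 * N) (U t) i) (at t within {0..})"
        by (rule U(2))
    next
      fix t :: real assume t: "t \<in> {0..T}"
      then have t': "0 \<le> t" "t \<le> T" by auto
      show "U t (i + 1) \<le> U t i" if "i \<in> {1..<2 * int N}" for i
        using S.reflect_decreasing[OF t' that] U(1)[OF t'] by simp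
      show "U t (2 * int N + 1 - i) = - U t i" if "i \<in> {1..2 * int N}" for i
        using that U(1)[OF t'] by (auto simp: reflect_def)
      have U1: "U t 1 = V t 1" using U(1)[OF t'] m by (simp add: reflect_def)
      have "b / 4 \<le> A - H.n * f * T / m - 2 * b * m / H.n" using e1 e2 \<epsilon> unfolding A_def by linarith
      then show "b / 4 \<le> U t 1" using S.V_first_ge[OF t'] U1 by linarith
      show "U t 1 \<le> b / 4 + 4 * \<epsilon>" using S.V_first_le[OF t'] U1 by (simp add: A_def)
      show "U t i \<le> exp (- 2 * \<kappa> * t) * (b / 4) + \<epsilon>"
        if i: "i \<in> {1..2 * int N}" and large_i: "\<epsilon> * (2 * real N) < i" for i
      proof (cases "i \<le> int N")
        case True
        have "\<rho> * (2 * real N) \<le> \<epsilon> * (2 * real N)" using \<rho> Npos by (intro mult_right_mono) auto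
        then have "int m < i" using m_le large_i by linarith
        then have "V t i \<le> exp (- 2 * \<kappa> * t) * H.w i" using True by (intro S.right_part_le t') auto
        also have "\<dots> \<le> exp (- 2 * \<kappa> * t) * (b / 4 + \<epsilon>)"
          using H.w_le[of i] i e3(1) by (intro mult_left_mono) auto
        also have "\<dots> \<le> exp (- 2 * \<kappa> * t) * (b / 4) + \<epsilon>"
          using \<epsilon> \<kappa> t' mult_right_mono[of "exp (- 2 * \<kappa> * t)" 1 \<epsilon>] by (simp add: distrib_left)
        finally show ?thesis using True U(1)[OF t'] by (simp add: reflect_def)
      next
        case False
        then have "U t i \<le> 0" using S.V_nonneg[OF t', of "2 * int N + 1 - i"] i U(1)[OF t']
          by (simp add: reflect_def)
        also have "0 \<le> exp (- 2 * \<kappa> * t) * (b / 4) + \<epsilon>" using b \<epsilon> by (intro add_nonneg_nonneg) auto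
        finally show ?thesis .
      qed
    next
      fix i assume i: "i \<in> {1..int N}"
      have U0: "U 0 i = H.init i" using U(1)[of 0 i] V(1)[OF i] i T by (simp add: reflect_def)
      have "0 \<le> b * (i / (2 * real N))\<^sup>2" using b by simp
      then show "b / 4 - b * (i / (2 * real N))\<^sup>2 \<le> U 0 i"
        using H.w_ge[of i] i \<epsilon> unfolding U0 H.init_def by (auto simp: A_def)
    next
      show "U 0 1 = b / 4 + 4 * \<epsilon>"
        using U(1)[of 0 1] V(1)[of 1] m T unfolding H.init_def by (simp add: reflect_def A_def)
    qed
    then show ?thesis by blast
  qed
  then show ?thesis by blast
qed

end

section \<open>Step functions on the grid\<close>

lemma discr_antimono:
  fixes v :: "int \<Rightarrow> real"
  assumes dec: "\<And>i. i \<in> {1..<int n} \<Longrightarrow> v (i + 1) \<le> v i" and ij: "1 \<le> i" "i \<le> j" "j \<le> int n"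
  shows "v j \<le> v i"
  using chain_le[of i j "\<lambda>j. - v j" 0] ij dec by simp

lemma discr_norm_antisymmetric:
  assumes n: "0 < n" and dec: "\<And>i. i \<in> {1..<int n} \<Longrightarrow> v (i + 1) \<le> v i"
    and anti: "v (int n) = - v 1"
  shows "discr_norm n v = v 1"
  unfolding discr_norm_def
proof (rule Max_eqI)
  have "v (int n) \<le> v 1" using discr_antimono[of n v, OF dec, of 1 "int n"] n by simp
  then have "v 1 = \<bar>v 1\<bar>" using anti by simp
  then show "v 1 \<in> (\<lambda>i. \<bar>v i\<bar>) ` {1..int n}" using n by (intro image_eqI[of _ _ 1]) auto
  fix y assume "y \<in> (\<lambda>i. \<bar>v i\<bar>) ` {1..int n}"
  then obtain i where "i \<in> {1..int n}" "y = \<bar>v i\<bar>" by auto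
  then show "y \<le> v 1"
    using discr_antimono[of n v, OF dec, of 1 i] discr_antimono[of n v, OF dec, of i "int n"] anti by auto
qed simp

lemma discr_TV_antisymmetric:
  assumes n: "0 < n" and dec: "\<And>i. i \<in> {1..<int n} \<Longrightarrow> v (i + 1) \<le> v i"
    and anti: "v (int n) = - v 1"
  shows "discr_TV n v = 2 * v 1"
proof -
  have "discr_TV n v = (\<Sum>i\<in>{1..int (n - 1)}. - v (i + 1) - - v (i - 1 + 1))"
    unfolding discr_TV_def using n dec by (intro sum.cong) (auto simp: of_nat_diff)
  also have "\<dots> = - v (int (n - 1) + 1) - - v (0 + 1)"
    by (rule sum_int_telescope[of "\<lambda>i. - v (i + 1)"])
  also have "\<dots> = 2 * v 1" using n anti by (simp add: of_nat_diff)
  finally show ?thesis .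
qed

lemma step_function_antimono:
  assumes n: "0 < n" and dec: "\<And>i. i \<in> {1..<int n} \<Longrightarrow> v (i + 1) \<le> v i"
  shows "antimono_on {0..1} (\<lambda>x. neumann_ext n v \<lceil>real n * x\<rceil>)"
proof (rule monotone_onI)
  fix x y :: real assume xy: "x \<in> {0..1}" "y \<in> {0..1}" "x \<le> y"
  let ?c = "\<lambda>x. max 1 \<lceil>real n * x\<rceil>"
  have ext: "neumann_ext n v z = v (max 1 z)" if "0 \<le> z" "z \<le> int n" for z
    using that by (auto simp: neumann_ext_def max_def)
  have c: "neumann_ext n v \<lceil>real n * x\<rceil> = v (?c x)" "?c x \<le> int n" if "x \<in> {0..1}" for x
  proof -
    have "0 \<le> real n * x" "real n * x \<le> real n * 1"
      using that mult_left_mono[of x 1 "real n"] by simp_all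
    then have "0 \<le> \<lceil>real n * x\<rceil>" "\<lceil>real n * x\<rceil> \<le> int n" by (auto simp: ceiling_le_iff)
    then show "neumann_ext n v \<lceil>real n * x\<rceil> = v (?c x)" "?c x \<le> int n"
      using n ext by auto
  qed
  have "\<lceil>real n * x\<rceil> \<le> \<lceil>real n * y\<rceil>" using xy by (intro ceiling_mono mult_left_mono) auto
  then show "neumann_ext n v \<lceil>real n * y\<rceil> \<le> neumann_ext n v \<lceil>real n * x\<rceil>"
    unfolding c(1)[OF xy(1)] c(1)[OF xy(2)] using c(2)[OF xy(2)]
    by (intro discr_antimono[of n v, OF dec]) auto
qed

lemma step_function_has_integral:
  fixes e :: "int \<Rightarrow> real"
  assumes n: "0 < n" and \<theta>: "0 \<le> \<theta>" "\<theta> \<le> 1"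
  shows "((\<lambda>y. e \<lceil>real n * y\<rceil>) has_integral ((\<Sum>j\<in>{1..int i}. e j) + \<theta> * e (int i + 1)) / real n)
    {0..(real i + \<theta>) / real n}"
  using \<theta>
proof (induction i arbitrary: \<theta>)
  have piece: "((\<lambda>y. e \<lceil>real n * y\<rceil>) has_integral \<theta> * e (int i + 1) / real n)
      {real i / real n..(real i + \<theta>) / real n}" if "0 \<le> \<theta>" "\<theta> \<le> 1" for i \<theta>
  proof (rule has_integral_spike_finite[where S = "{real i / real n}" and f = "\<lambda>_. e (int i + 1)"])
    show "e \<lceil>real n * y\<rceil> = e (int i + 1)"
      if y: "y \<in> {real i / real n..(real i + \<theta>) / real n} - {real i / real n}" for y
    proof -
      have "real i / real n < y" "y \<le> (real i + \<theta>) / real n" using y by auto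
      then have "real i < real n * y" "real n * y \<le> real i + \<theta>" using n by (simp_all add: field_simps)
      then have "\<lceil>real n * y\<rceil> = int i + 1" using \<open>\<theta> \<le> 1\<close> by linarith
      then show ?thesis by simp
    qed
    show "((\<lambda>_. e (int i + 1)) has_integral \<theta> * e (int i + 1) / real n) {real i / real n..(real i + \<theta>) / real n}"
      using has_integral_const_real[of "e (int i + 1)" "real i / real n" "(real i + \<theta>) / real n"] n that
      by (simp add: add_divide_distrib)
  qed simp
  {
    case 0
    then show ?case using piece[of \<theta> 0] by simp
  next
    case (Suc i)
    have "((\<lambda>y. e \<lceil>real n * y\<rceil>) has_integral
        ((\<Sum>j\<in>{1..int i}. e j) + 1 * e (int i + 1)) / real n + \<theta> * e (int (Suc i) + 1) / real n)
        {0..(real (Suc i) + \<theta>) / real n}"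
    proof (rule has_integral_combine)
      show "((\<lambda>y. e \<lceil>real n * y\<rceil>) has_integral ((\<Sum>j\<in>{1..int i}. e j) + 1 * e (int i + 1)) / real n)
          {0..real (Suc i) / real n}" using Suc.IH[of 1] by (simp add: add.commute)
    qed (use piece[of \<theta> "Suc i"] Suc.prems n in \<open>auto intro: divide_right_mono\<close>)
    moreover have "{1..int (Suc i)} = insert (int i + 1) {1..int i}" by auto
    then have "(\<Sum>j\<in>{1..int (Suc i)}. e j) = (\<Sum>j\<in>{1..int i}. e j) + 1 * e (int i + 1)" by simp
    ultimately show ?case by (simp only: add_divide_distrib)
  }
qed

text \<open>Both primitives are affine on each cell, so their difference is a convex combination of its values at
grid points, which are the partial sums.\<close>
lemma step_primitive_diff_le:
  fixes e d :: "int \<Rightarrow> real"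
  assumes n: "0 < n" and x: "x \<in> {0..1}"
    and sums: "\<And>i. i \<le> n \<Longrightarrow> \<bar>(\<Sum>j\<in>{1..int i}. e j) - (\<Sum>j\<in>{1..int i}. d j)\<bar> \<le> real n * c"
  shows "\<bar>integral {0..x} (\<lambda>y. e \<lceil>real n * y\<rceil>) - integral {0..x} (\<lambda>y. d \<lceil>real n * y\<rceil>)\<bar> \<le> c"
proof (cases "x = 0")
  case True
  have "0 \<le> real n * c" using sums[of 0] by simp
  then show ?thesis using True n by (simp add: zero_le_mult_iff)
next
  case False
  define i where "i = nat (\<lceil>real n * x\<rceil> - 1)"
  define \<theta> where "\<theta> = real n * x - real i"
  have nx: "0 < real n * x" "real n * x \<le> real n * 1"
    using False x n mult_left_mono[of x 1 "real n"] by simp_all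
  then have c1: "1 \<le> \<lceil>real n * x\<rceil>" "\<lceil>real n * x\<rceil> \<le> int n" by (auto simp: ceiling_le_iff)
  then have ri: "real i = real_of_int \<lceil>real n * x\<rceil> - 1" by (simp add: i_def)
  have \<theta>: "0 \<le> \<theta>" "\<theta> \<le> 1" unfolding \<theta>_def ri by linarith+
  have i: "Suc i \<le> n" using c1 unfolding i_def by linarith
  have x_eq: "x = (real i + \<theta>) / real n" using n by (simp add: \<theta>_def)
  let ?E = "\<lambda>i. \<Sum>j\<in>{1..int i}. e j" and ?D = "\<lambda>i. \<Sum>j\<in>{1..int i}. d j"
  have "{1..int (Suc i)} = insert (int i + 1) {1..int i}" by auto
  then have s: "?E (Suc i) = ?E i + e (int i + 1)" "?D (Suc i) = ?D i + d (int i + 1)" by simp_all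
  have "integral {0..x} (\<lambda>y. e \<lceil>real n * y\<rceil>) - integral {0..x} (\<lambda>y. d \<lceil>real n * y\<rceil>)
      = (?E i + \<theta> * e (int i + 1)) / real n - (?D i + \<theta> * d (int i + 1)) / real n"
    unfolding x_eq using step_function_has_integral[OF n \<theta>, THEN integral_unique] by simp
  also have "\<dots> = ((1 - \<theta>) * (?E i - ?D i) + \<theta> * (?E (Suc i) - ?D (Suc i))) / real n"
    unfolding s diff_divide_distrib[symmetric] by (simp add: algebra_simps)
  also have "\<bar>\<dots>\<bar> \<le> ((1 - \<theta>) * (real n * c) + \<theta> * (real n * c)) / real n"
  proof -
    have "\<bar>(1 - \<theta>) * (?E i - ?D i)\<bar> \<le> (1 - \<theta>) * (real n * c)"
      using sums[of i] i \<theta> by (simp add: abs_mult mult_left_mono)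
    moreover have "\<bar>\<theta> * (?E (Suc i) - ?D (Suc i))\<bar> \<le> \<theta> * (real n * c)"
      using sums[of "Suc i"] i \<theta> unfolding abs_mult by (intro mult_mono) auto
    ultimately have "\<bar>(1 - \<theta>) * (?E i - ?D i) + \<theta> * (?E (Suc i) - ?D (Suc i))\<bar>
        \<le> (1 - \<theta>) * (real n * c) + \<theta> * (real n * c)" by linarith
    then show ?thesis by (simp add: divide_right_mono)
  qed
  also have "\<dots> = c" using n by (simp add: algebra_simps)
  finally show ?thesis .
qed

text \<open>Telescoping the equation over the first \<open>i\<close> points leaves the single flux through edge \<open>i\<close>, which is
bounded by \<open>Mp\<close>.\<close>
lemma (in pm_flux) semidiscrete_primitive_lipschitz:
  assumes n: "0 < n"
    and U: "\<And>t i. \<lbrakk>0 \<le> t; i \<in> {1..int n}\<rbrakk> \<Longrightarrow>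
      ((\<lambda>s. U s i) has_real_derivative semidiscrete n (U t) i) (at t within {0..})"
    and st: "0 \<le> s" "0 \<le> t" and x: "x \<in> {0..1}"
  shows "\<bar>integral {0..x} (\<lambda>y. neumann_ext n (U s) \<lceil>real n * y\<rceil>)
    - integral {0..x} (\<lambda>y. neumann_ext n (U t) \<lceil>real n * y\<rceil>)\<bar> \<le> Mp * \<bar>s - t\<bar>"
proof (rule step_primitive_diff_le[OF n x])
  fix i assume i: "i \<le> n"
  let ?q = "\<lambda>t j. p (Dplus n (neumann_ext n (U t)) j)"
  have ext: "(\<Sum>j\<in>{1..int i}. neumann_ext n (U t) j) = (\<Sum>j\<in>{1..int i}. U t j)" for t
    using i by (intro sum.cong) (auto simp: neumann_ext_def)
  have "norm ((\<Sum>j\<in>{1..int i}. U s j) - (\<Sum>j\<in>{1..int i}. U t j)) \<le> (real n * Mp) * norm (s - t)"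
  proof (rule field_differentiable_bound[where S = "{0..}" and f' = "\<lambda>t. real n * ?q t (int i)"])
    show "((\<lambda>t. \<Sum>j\<in>{1..int i}. U t j) has_real_derivative real n * ?q t (int i)) (at t within {0..})"
      if "t \<in> {0..}" for t
    proof -
      have "((\<lambda>t. \<Sum>j\<in>{1..int i}. U t j) has_real_derivative (\<Sum>j\<in>{1..int i}. semidiscrete n (U t) j)) (at t within {0..})"
        using that i by (intro DERIV_sum U) auto
      also have "(\<Sum>j\<in>{1..int i}. semidiscrete n (U t) j) = real n * (?q t (int i) - ?q t 0)"
        unfolding semidiscrete_def Dminus_def
        by (simp only: sum_int_telescope[of "?q t"] flip: sum_distrib_left)
      also have "?q t 0 = 0" using n by (simp add: Dplus_def neumann_ext_def)
      finally show ?thesis by simp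
    qed
    show "norm (real n * ?q t (int i)) \<le> real n * Mp" for t
      using bdd by (simp add: abs_mult mult_left_mono)
  qed (use st in auto)
  then show "\<bar>(\<Sum>j\<in>{1..int i}. neumann_ext n (U s) j) - (\<Sum>j\<in>{1..int i}. neumann_ext n (U t) j)\<bar>
      \<le> real n * (Mp * \<bar>s - t\<bar>)"
    unfolding ext by (simp add: mult.assoc)
qed

section \<open>Essential supremum and total variation of monotone functions\<close>

lemma AE_unit_leb_countable:
  assumes "countable C" "\<And>x. x \<in> {0<..<1} - C \<Longrightarrow> Q x"
  shows "AE x in unit_leb. Q x"
proof (rule AE_I'[where N = "C \<inter> {0<..<1}"])
  have "C \<inter> {0<..<1} \<in> null_sets lebesgue"
    using assms(1) by (intro null_sets_completionI countable_imp_null_set_lborel) auto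
  then show "C \<inter> {0<..<1} \<in> null_sets unit_leb" by (simp add: null_sets_restrict_space)
qed (use assms(2) in auto)

lemma AE_unit_leb_witness:
  assumes "AE x in unit_leb. Q x" "0 \<le> a" "a < b" "b \<le> 1"
  obtains x where "a < x" "x < b" "Q x"
proof (rule ccontr)
  assume no: "\<not> thesis"
  obtain N where N: "{x \<in> space unit_leb. \<not> Q x} \<subseteq> N" "N \<in> null_sets unit_leb"
    using AE_E[OF assms(1)] by (metis null_setsI)
  have sub: "{a<..<b} \<subseteq> N" using no that N(1) assms(2-4) by fastforce
  have "N \<in> null_sets lebesgue" using N(2) by (simp add: null_sets_restrict_space)
  then have "{a<..<b} \<in> null_sets lebesgue" by (rule null_sets_subset[OF _ _ sub]) simp
  then have "emeasure lebesgue {a<..<b} = 0" by auto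
  then show False using assms(3) by simp
qed

lemma pointwise_variation_antimono_le:
  assumes anti: "antimono_on {0<..<1} v" and c: "\<And>x. x \<in> {0<..<1} \<Longrightarrow> \<bar>v x\<bar> \<le> c"
  shows "pointwise_variation v \<le> ereal (2 * c)"
  unfolding pointwise_variation_def
proof (rule SUP_least, clarify)
  fix N :: nat and q :: "nat \<Rightarrow> real"
  assume q: "mono_on {..N} q" "q ` {..N} \<subseteq> {0<..<1}"
  have "\<bar>v (q (Suc i)) - v (q i)\<bar> = - v (q (Suc i)) - - v (q i)" if "i < N" for i
  proof -
    have "q i \<in> {0<..<1}" "q (Suc i) \<in> {0<..<1}" using that q(2) by (auto simp: image_subset_iff)
    moreover have "q i \<le> q (Suc i)" using that by (intro mono_onD[OF q(1)]) auto
    ultimately show ?thesis using monotone_onD[OF anti, of "q i" "q (Suc i)"] by auto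
  qed
  then have "(\<Sum>i<N. \<bar>v (q (Suc i)) - v (q i)\<bar>) = (\<Sum>i<N. - v (q (Suc i)) - - v (q i))"
    by (intro sum.cong) auto
  also have "\<dots> = - v (q N) - - v (q 0)" by (rule sum_lessThan_telescope)
  also have "\<dots> \<le> 2 * c" using c[of "q N"] c[of "q 0"] q(2) by force
  finally show "ereal (\<Sum>i<N. \<bar>v (q (Suc i)) - v (q i)\<bar>) \<le> ereal (2 * c)" by simp
qed

text \<open>The left limits of a monotone function form its left-continuous representative; it is monotone, so
every variation sum is the difference of two of its values, each bounded by \<open>c\<close>.\<close>
lemma TV_unit_antimono_le:
  assumes anti: "antimono_on {0..1} f" and ae: "AE x in unit_leb. \<bar>f x\<bar> \<le> c"
  shows "TV_unit f \<le> ereal (2 * c)"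
proof -
  define v where "v x = (INF y\<in>{0<..<x}. f y)" for x
  have bb: "bdd_below (f ` {0<..<x})" if "x \<in> {0<..<1}" for x
    using that anti by (intro bdd_belowI2[of _ "f 1"]) (auto simp: monotone_on_def)
  have v_le: "v x \<le> f y" if "x \<in> {0<..<1}" "0 < y" "y < x" for x y
    unfolding v_def using that by (intro cINF_lower bb) auto
  have v_ge: "l \<le> v x" if "x \<in> {0<..<1}" "\<And>y. 0 < y \<Longrightarrow> y < x \<Longrightarrow> l \<le> f y" for x l
    unfolding v_def using that by (intro cINF_greatest) auto
  have fv: "f x \<le> v x" if "x \<in> {0<..<1}" for x
    using that anti by (intro v_ge) (auto simp: monotone_on_def)
  have v_anti: "antimono_on {0<..<1} v"
  proof (rule monotone_onI)
    fix x y :: real assume "x \<in> {0<..<1}" "y \<in> {0<..<1}" "x \<le> y"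
    then show "v y \<le> v x" by (intro v_ge v_le) auto
  qed
  have left: "(v \<longlongrightarrow> v x) (at_left x)" if x: "x \<in> {0<..<1}" for x
  proof (rule order_tendstoI)
    fix a assume "a < v x"
    moreover have "v x \<le> v y" if "y \<in> {0<..<x}" for y
      using that x by (intro monotone_onD[OF v_anti]) auto
    ultimately show "\<forall>\<^sub>F y in at_left x. a < v y"
      using eventually_at_left_real[of 0 x] x by (auto elim!: eventually_mono intro: less_le_trans)
  next
    fix a assume "v x < a"
    then obtain z where z: "z \<in> {0<..<x}" "f z < a"
      unfolding v_def using x by (subst (asm) cINF_less_iff) (auto intro: bb)
    have "v y < a" if "y \<in> {z<..<x}" for y
      using v_le[of y z] that z x by auto
    then show "\<forall>\<^sub>F y in at_left x. v y < a"
      using eventually_at_left_real[of z x] z by (auto elim!: eventually_mono)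
  qed
  define C where "C = {a\<in>{0<..<1}. \<not> isCont (\<lambda>x. - f x) a}"
  have "mono_on {0<..<1} (\<lambda>x. - f x)" using anti by (auto simp: monotone_on_def)
  then have C: "countable C" unfolding C_def by (intro mono_on_ctble_discont_open) auto
  have "v x = f x" if x: "x \<in> {0<..<1} - C" for x
  proof (rule antisym)
    have "isCont (\<lambda>x. - f x) x" using x by (auto simp: C_def)
    then have "isCont (\<lambda>x. - (- f x)) x" by (rule isCont_minus)
    then have "(f \<longlongrightarrow> f x) (at_left x)" by (simp add: isCont_def filterlim_at_split)
    moreover have "\<forall>\<^sub>F y in at_left x. v x \<le> f y"
      using eventually_at_left_real[of 0 x] x v_le[of x] by (auto elim!: eventually_mono)
    ultimately show "v x \<le> f x" by (rule tendsto_lowerbound) simp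
  qed (use fv x in auto)
  then have "AE x in unit_leb. v x = f x" by (intro AE_unit_leb_countable[OF C]) auto
  then have rep: "left_cont_rep f v" using left by (simp add: left_cont_rep_def)
  have "\<bar>v x\<bar> \<le> c" if x: "x \<in> {0<..<1}" for x
  proof -
    obtain y where y: "0 < y" "y < x" "\<bar>f y\<bar> \<le> c" using AE_unit_leb_witness[OF ae, of 0 x] x by auto
    obtain z where z: "x < z" "z < 1" "\<bar>f z\<bar> \<le> c" using AE_unit_leb_witness[OF ae, of x 1] x by auto
    have "f z \<le> f x" using z x by (intro monotone_onD[OF anti]) auto
    then show ?thesis using v_le[OF x y(1,2)] fv[OF x] y z by linarith
  qed
  then have "pointwise_variation v \<le> ereal (2 * c)" by (intro pointwise_variation_antimono_le v_anti)
  moreover have "TV_unit f \<le> pointwise_variation v"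
    unfolding TV_unit_def using rep by (intro INF_lower) simp
  ultimately show ?thesis by (rule order_trans[rotated])
qed

text \<open>Every representative takes values close to \<open>\<beta>\<close> near the left end and close to \<open>- \<beta>\<close> near the right
end, since almost everywhere bounds hold at points arbitrarily close to the ends.\<close>
lemma TV_unit_ge:
  assumes lo: "AE x in unit_leb. x < 1/4 \<longrightarrow> \<beta> - C * x \<le> f x"
    and hi: "AE x in unit_leb. 3/4 < x \<longrightarrow> f x \<le> - (\<beta> - C * (1 - x))"
    and C: "0 \<le> C"
  shows "ereal (2 * \<beta>) \<le> TV_unit f"
  unfolding TV_unit_def
proof (rule INF_greatest)
  fix v assume "v \<in> {v. left_cont_rep f v}"
  then have vf: "AE x in unit_leb. v x = f x" by (simp add: left_cont_rep_def)
  have lo': "AE x in unit_leb. x < 1/4 \<longrightarrow> \<beta> - C * x \<le> v x" using vf lo by eventually_elim simp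
  have hi': "AE x in unit_leb. 3/4 < x \<longrightarrow> v x \<le> - (\<beta> - C * (1 - x))" using vf hi by eventually_elim simp
  show "ereal (2 * \<beta>) \<le> pointwise_variation v"
  proof (rule ereal_le_epsilon2)
    fix e :: real assume e: "0 < e"
    define \<delta> where "\<delta> = min (1/4) (e / 2 / (C + 1))"
    have \<delta>: "0 < \<delta>" "\<delta> \<le> 1/4"
      using e C unfolding \<delta>_def by (simp, intro min.cobounded1)
    have "C * \<delta> \<le> (C + 1) * (e / 2 / (C + 1))" using C e by (intro mult_mono) (auto simp: \<delta>_def)
    also have "(C + 1) * (e / 2 / (C + 1)) = e / 2" using C by (intro nonzero_mult_div_cancel_left[of "C + 1" "e / 2", folded times_divide_eq_right]) simp
    finally have C\<delta>: "C * \<delta> \<le> e / 2" .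
    obtain y where y: "0 < y" "y < \<delta>" "\<beta> - C * y \<le> v y"
      by (rule AE_unit_leb_witness[OF lo', of 0 \<delta>]) (use \<delta> in auto)
    obtain z where z: "1 - \<delta> < z" "z < 1" "v z \<le> - (\<beta> - C * (1 - z))"
      by (rule AE_unit_leb_witness[OF hi', of "1 - \<delta>" 1]) (use \<delta> in auto)
    have "C * y \<le> C * \<delta>" "C * (1 - z) \<le> C * \<delta>" using y z C by (auto intro: mult_left_mono)
    then have "2 * \<beta> - e \<le> v y - v z" using y z C\<delta> by linarith
    then have "ereal (2 * \<beta>) \<le> ereal \<bar>v z - v y\<bar> + ereal e" by simp
    also have "ereal \<bar>v z - v y\<bar> \<le> pointwise_variation v"
      unfolding pointwise_variation_def
      by (rule SUP_upper2[of "(1, \<lambda>i. if i = 0 then y else z)"])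
         (use y z \<delta> in \<open>auto simp: mono_on_def\<close>)
    then have "ereal \<bar>v z - v y\<bar> + ereal e \<le> pointwise_variation v + ereal e"
      by (rule add_right_mono)
    finally show "ereal (2 * \<beta>) \<le> pointwise_variation v + ereal e" .
  qed
qed

lemma Linf_norm_unit_ge:
  assumes lo: "AE x in unit_leb. x < 1/4 \<longrightarrow> \<beta> - C * x \<le> f x" and C: "0 \<le> C"
  shows "ereal \<beta> \<le> Linf_norm_unit f"
proof (rule ereal_le_epsilon2)
  fix e :: real assume e: "0 < e"
  define \<delta> where "\<delta> = min (1/4) (e / (C + 1))"
  have \<delta>: "0 < \<delta>" "\<delta> \<le> 1/4"
      using e C unfolding \<delta>_def by (simp, intro min.cobounded1)
  have "C * \<delta> \<le> (C + 1) * (e / (C + 1))" using C e by (intro mult_mono) (auto simp: \<delta>_def)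
  then have C\<delta>: "C * \<delta> \<le> e" using C by simp
  have "AE x in unit_leb. ereal \<bar>f x\<bar> \<le> Linf_norm_unit f"
    unfolding Linf_norm_unit_def by (rule esssup_AE)
  then have ae: "AE x in unit_leb. (x < 1/4 \<longrightarrow> \<beta> - C * x \<le> f x) \<and> ereal \<bar>f x\<bar> \<le> Linf_norm_unit f"
    using lo by eventually_elim simp
  obtain y where y: "0 < y" "y < \<delta>" "(y < 1/4 \<longrightarrow> \<beta> - C * y \<le> f y) \<and> ereal \<bar>f y\<bar> \<le> Linf_norm_unit f"
    by (rule AE_unit_leb_witness[OF ae, of 0 \<delta>]) (use \<delta> in auto)
  have "C * y \<le> C * \<delta>" using y C by (auto intro: mult_left_mono)
  then have "\<beta> \<le> \<bar>f y\<bar> + e" using y \<delta> C\<delta> by auto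
  then have "ereal \<beta> \<le> ereal \<bar>f y\<bar> + ereal e" by simp
  also have "\<dots> \<le> Linf_norm_unit f + ereal e" using y by (intro add_right_mono) auto
  finally show "ereal \<beta> \<le> Linf_norm_unit f + ereal e" .
qed

lemma Linf_norm_unit_le:
  assumes "f \<in> borel_measurable unit_leb" "AE x in unit_leb. \<bar>f x\<bar> \<le> c"
  shows "Linf_norm_unit f \<le> ereal c"
  unfolding Linf_norm_unit_def
  using assms by (intro esssup_I) auto

section \<open>Loss of strict convergence\<close>

theorem theorem2p6:
  fixes \<phi> :: "real \<Rightarrow> real"
  assumes "pm_potential \<phi>"
  shows "\<exists>(u :: real \<Rightarrow> real \<Rightarrow> real) (n :: nat \<Rightarrow> nat) (U :: nat \<Rightarrow> real \<Rightarrow> int \<Rightarrow> real).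
    generalized_solution_with \<phi> u n U \<and>
    liminf (\<lambda>k. ereal (discr_norm (n k) (U k 0))) = Linf_norm_unit (u 0) \<and>
    liminf (\<lambda>k. ereal (discr_TV (n k) (U k 0))) = TV_unit (u 0) \<and>
    (\<forall>t>0. liminf (\<lambda>k. ereal (discr_norm (n k) (U k t))) > Linf_norm_unit (u t) \<and>
           liminf (\<lambda>k. ereal (discr_TV (n k) (U k t))) > TV_unit (u t))"
proof -
  obtain \<kappa> sb Lp Mp where "pm_flux (deriv \<phi>) \<kappa> sb Lp Mp"
    using pm_potential_flux[OF assms] .
  then interpret F: pm_flux "deriv \<phi>" \<kappa> sb Lp Mp .
  define b where "b = sb / 2"
  have b: "0 < b" "2 * b \<le> sb" using F.sb by (auto simp: b_def)
  define \<epsilon> where "\<epsilon> k = 1 / real (Suc k)" for k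
  define T where "T k = real (Suc k)" for k
  have \<epsilon>: "0 < \<epsilon> k" "\<epsilon> k \<le> 1" for k by (auto simp: \<epsilon>_def)
  have \<epsilon>_lim: "\<epsilon> \<longlonglongrightarrow> 0" unfolding \<epsilon>_def by (rule LIMSEQ_Suc[OF lim_1_over_n])
  have "\<exists>N0. \<forall>N\<ge>N0. \<exists>U. F.plateau_scheme b N (\<epsilon> k) (T k) U" for k
    using b \<epsilon> by (intro F.plateau_scheme_exists) (auto simp: T_def)
  then obtain N0 where N0: "\<And>k N. N \<ge> N0 k \<Longrightarrow> \<exists>U. F.plateau_scheme b N (\<epsilon> k) (T k) U" by metis
  define N where "N k = (\<Sum>j\<le>k. N0 j) + k + 2" for k
  have N_ge: "N0 k \<le> N k" "k + 2 \<le> N k" for k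
    using member_le_sum[of k "{..k}" N0] by (simp_all add: N_def)
  have N_mono: "strict_mono N" by (rule strict_monoI_Suc) (simp add: N_def)
  define n where "n k = 2 * N k" for k
  have n: "0 < n k" "int (n k) = 2 * int (N k)" "real (n k) = 2 * real (N k)" for k
    using N_ge(2)[of k] by (auto simp: n_def)
  have n_mono: "strict_mono n" using N_mono by (simp add: strict_mono_def n_def)
  define W where "W k = (SOME U. F.plateau_scheme b (N k) (\<epsilon> k) (T k) U)" for k
  have W: "F.plateau_scheme b (N k) (\<epsilon> k) (T k) (W k)" for k
    unfolding W_def using N0[OF N_ge(1)] by (rule someI_ex)
  have ode: "((\<lambda>s. W k s i) has_real_derivative F.semidiscrete (n k) (W k t) i) (at t within {0..})"
    if "0 \<le> t" "i \<in> {1..int (n k)}" for k t i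
    using W[of k] that unfolding F.plateau_scheme_def n_def by blast
  have dec: "W k t (i + 1) \<le> W k t i" if "t \<in> {0..T k}" "i \<in> {1..<int (n k)}" for k t i
    using W[of k] that unfolding F.plateau_scheme_def n by blast
  have anti: "W k t (int (n k) + 1 - i) = - W k t i" if "t \<in> {0..T k}" "i \<in> {1..int (n k)}" for k t i
    using W[of k] that unfolding F.plateau_scheme_def n by blast
  have first: "b / 4 \<le> W k t 1" "W k t 1 \<le> b / 4 + 4 * \<epsilon> k" if "t \<in> {0..T k}" for k t
    using W[of k] that unfolding F.plateau_scheme_def by blast+
  have decay: "W k t i \<le> exp (- 2 * \<kappa> * t) * (b / 4) + \<epsilon> k"
    if "t \<in> {0..T k}" "i \<in> {1..int (n k)}" "\<epsilon> k * real (n k) < i" for k t i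
    using W[of k] that unfolding F.plateau_scheme_def n by blast
  have init: "b / 4 - b * (i / real (n k))\<^sup>2 \<le> W k 0 i" if "i \<in> {1..int (N k)}" for k i
    using W[of k] that unfolding F.plateau_scheme_def n by blast
  have init1: "W k 0 1 = b / 4 + 4 * \<epsilon> k" for k
    using W[of k] unfolding F.plateau_scheme_def by blast
  have T0: "0 \<in> {0..T k}" for k by (simp add: T_def)
  have norm_eq: "discr_norm (n k) (W k t) = W k t 1" and TV_eq: "discr_TV (n k) (W k t) = 2 * W k t 1"
    if t: "t \<in> {0..T k}" for k t
    using discr_norm_antisymmetric[of "n k" "W k t"] discr_TV_antisymmetric[of "n k" "W k t"]
      n(1)[of k] dec[OF t] anti[OF t, of 1] by auto
  have Wbound: "\<bar>W k t i\<bar> \<le> b / 4 + 4" if t: "t \<in> {0..T k}" and i: "i \<in> {1..int (n k)}" for k t i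
  proof -
    have "W k t i \<le> W k t 1" "W k t (int (n k) + 1 - i) \<le> W k t 1"
      using i by (auto intro!: discr_antimono[of "n k" "W k t"] dec[OF t])
    then show ?thesis using anti[OF t i] first(2)[OF t] \<epsilon>(2)[of k] by auto
  qed
  \<comment> \<open>stopping at \<open>T k\<close> makes monotonicity and bounds available for all times; index \<open>0\<close>, which occurs at \<open>x = 0\<close>, takes the first value\<close>
  define V where "V k t x = neumann_ext (n k) (W k (min t (T k))) \<lceil>real (n k) * x\<rceil>" for k t x
  have min_T: "min t (T k) \<in> {0..T k}" if "0 \<le> t" for t k using that by (auto simp: T_def)
  have V_antimono: "antimono_on {0..1} (V k t)" if "0 \<le> t" for k t
    unfolding V_def using n(1) dec[OF min_T[OF that]] by (rule step_function_antimono)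
  have V_bound: "\<bar>V k t x\<bar> \<le> b / 4 + 4" if "0 \<le> t" "x \<in> {0..1}" for k t x
  proof -
    have "0 \<le> real (n k) * x" "real (n k) * x \<le> real (n k)"
      using that(2) mult_left_mono[of x 1 "real (n k)"] by simp_all
    then have "\<lceil>real (n k) * x\<rceil> \<in> {0..int (n k) + 1}" by (auto simp: ceiling_le_iff)
    then obtain j where "j \<in> {1..int (n k)}" "\<And>v. neumann_ext (n k) v \<lceil>real (n k) * x\<rceil> = v j"
      using F.neumann_ext_in[OF n(1)] by blast
    then show ?thesis unfolding V_def using Wbound[OF min_T[OF that(1)]] by simp
  qed
  have V_lip: "\<bar>integral {0..x} (V k s) - integral {0..x} (V k t)\<bar> \<le> Mp * \<bar>s - t\<bar>"
    if "0 \<le> s" "0 \<le> t" "x \<in> {0..1}" for k s t x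
  proof -
    have "\<bar>integral {0..x} (V k s) - integral {0..x} (V k t)\<bar> \<le> Mp * \<bar>min s (T k) - min t (T k)\<bar>"
      unfolding V_def
      by (rule F.semidiscrete_primitive_lipschitz[OF n(1) ode]) (use that T0[of k] in auto)
    also have "\<dots> \<le> Mp * \<bar>s - t\<bar>" using F.bdd[of 0] by (intro mult_left_mono) auto
    finally show ?thesis .
  qed
  have Mp: "0 \<le> Mp" using F.bdd[of 0] by simp
  obtain r u where r: "strict_mono r"
    and u_antimono: "\<And>t. 0 \<le> t \<Longrightarrow> antimono_on {0..1} (u t)"
    and "\<And>t x. 0 \<le> t \<Longrightarrow> x \<in> {0..1} \<Longrightarrow> \<bar>u t x\<bar> \<le> b / 4 + 4"
    and u_lim: "\<And>t. 0 \<le> t \<Longrightarrow> \<exists>C. countable C \<and> (\<forall>x\<in>{0<..<1} - C. (\<lambda>k. V (r k) t x) \<longlonglongrightarrow> u t x)"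
    and u_L2: "\<And>T e. 0 < e \<Longrightarrow> \<forall>\<^sub>F k in sequentially. \<forall>t\<in>{0..T}. L2_norm_unit (\<lambda>x. V (r k) t x - u t x) \<le> e"
    and u_cont: "C0_L2 u"
  proof (rule antimono_family_compactness[of V "b / 4 + 4" Mp])
    show "antimono_on {0..1} (V k t)" if "0 \<le> t" for k t by (rule V_antimono[OF that])
    show "\<bar>V k t x\<bar> \<le> b / 4 + 4" if "0 \<le> t" "x \<in> {0..1}" for k t x by (rule V_bound[OF that])
    show "\<bar>integral {0..x} (V k s) - integral {0..x} (V k t)\<bar> \<le> Mp * \<bar>s - t\<bar>"
      if "0 \<le> s" "0 \<le> t" "x \<in> {0..1}" for k s t x by (rule V_lip[OF that])
  qed (rule Mp, rule that)
  have r_lim: "filterlim r at_top sequentially" using r by (rule filterlim_subseq)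
  have \<epsilon>r_lim: "(\<lambda>k. \<epsilon> (r k)) \<longlonglongrightarrow> 0" using filterlim_compose[OF \<epsilon>_lim r_lim] .
  have T_large: "\<forall>\<^sub>F k in sequentially. t \<le> T (r k)" for t
  proof -
    obtain m where "t \<le> real m" using real_arch_simple by blast
    then have "t \<le> T (r k)" if "m \<le> k" for k
      using seq_suble[OF r, of k] that by (simp add: T_def)
    then show ?thesis unfolding eventually_sequentially by blast
  qed
  have cell: "\<lceil>real (n k) * x\<rceil> \<in> {1..int (n k)}" "real (n k) * x \<le> \<lceil>real (n k) * x\<rceil>"
      "\<lceil>real (n k) * x\<rceil> < real (n k) * x + 1"
    if "x \<in> {0<..<1}" for k x
  proof -
    have "0 < real (n k) * x" "real (n k) * x \<le> real (n k)"
      using that n(1)[of k] mult_left_mono[of x 1 "real (n k)"] by auto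
    then show "\<lceil>real (n k) * x\<rceil> \<in> {1..int (n k)}" by (auto simp: ceiling_le_iff)
    show "real (n k) * x \<le> \<lceil>real (n k) * x\<rceil>" "\<lceil>real (n k) * x\<rceil> < real (n k) * x + 1" by linarith+
  qed
  have ext: "neumann_ext m v i = v i" if "i \<in> {1..int m}" for m v i
    using that by (simp add: neumann_ext_def)
  have V_eq: "V k t x = W k t \<lceil>real (n k) * x\<rceil>" if "t \<in> {0..T k}" "x \<in> {0<..<1}" for k t x
    unfolding V_def ext[OF cell(1)[OF that(2)]] using that(1) by (simp add: min_def)
  have V_eq': "V k t x = - W k t (int (n k) + 1 - \<lceil>real (n k) * x\<rceil>)" if "t \<in> {0..T k}" "x \<in> {0<..<1}" for k t x
    using V_eq[OF that] anti[OF that(1) cell(1)[OF that(2)]] by simp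
  \<comment> \<open>a point \<open>x\<close> eventually lies neither in the plateau nor in its mirror image\<close>
  have u_decay: "AE x in unit_leb. \<bar>u t x\<bar> \<le> exp (- 2 * \<kappa> * t) * (b / 4)" if t: "0 \<le> t" for t
  proof -
    obtain C where C: "countable C" "\<And>x. x \<in> {0<..<1} - C \<Longrightarrow> (\<lambda>k. V (r k) t x) \<longlonglongrightarrow> u t x"
      using u_lim[OF t] by blast
    show ?thesis
    proof (rule AE_unit_leb_countable[OF C(1)])
      fix x assume x: "x \<in> {0<..<1} - C"
      have "\<forall>\<^sub>F k in sequentially. \<epsilon> (r k) < min x (1 - x)"
        using order_tendstoD(2)[OF \<epsilon>r_lim, of "min x (1 - x)"] x by simp
      then have ev: "\<forall>\<^sub>F k in sequentially. \<bar>V (r k) t x\<bar> \<le> exp (- 2 * \<kappa> * t) * (b / 4) + \<epsilon> (r k)"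
        using T_large[of t]
      proof eventually_elim
        case (elim k)
        let ?k = "r k"
        let ?i = "\<lceil>real (n ?k) * x\<rceil>"
        have tk: "t \<in> {0..T ?k}" and x': "x \<in> {0<..<1}" using elim t x by auto
        have "\<epsilon> ?k * real (n ?k) < real (n ?k) * x" "\<epsilon> ?k * real (n ?k) < real (n ?k) - real (n ?k) * x"
          using elim n(1)[of ?k] mult_strict_right_mono[of "\<epsilon> ?k" x "real (n ?k)"]
            mult_strict_right_mono[of "\<epsilon> ?k" "1 - x" "real (n ?k)"] by (simp_all add: algebra_simps)
        then have "\<epsilon> ?k * real (n ?k) < ?i" "\<epsilon> ?k * real (n ?k) < real_of_int (int (n ?k) + 1 - ?i)"
          using cell(2,3)[OF x', of ?k] unfolding of_int_diff of_int_add of_int_of_nat_eq of_int_1 by linarith+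
        note far = this
        have "int (n ?k) + 1 - ?i \<in> {1..int (n ?k)}" using cell(1)[OF x', of ?k] by simp
        from decay[OF tk cell(1)[OF x'] far(1)] decay[OF tk this far(2)]
        show ?case using V_eq[OF tk x'] V_eq'[OF tk x'] by linarith
      qed
      have lim: "(\<lambda>k. exp (- 2 * \<kappa> * t) * (b / 4) + \<epsilon> (r k)) \<longlonglongrightarrow> exp (- 2 * \<kappa> * t) * (b / 4) + 0"
        by (intro tendsto_intros \<epsilon>r_lim)
      show "\<bar>u t x\<bar> \<le> exp (- 2 * \<kappa> * t) * (b / 4)"
        using tendsto_le[OF trivial_limit_sequentially lim tendsto_rabs[OF C(2)[OF x]] ev] by simp
    qed
  qed
  define \<delta> where "\<delta> k = 1 / real (n (r k))" for k
  have "strict_mono (n \<circ> r)" using n_mono r by (simp add: strict_mono_o)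
  then have "filterlim (n \<circ> r) at_top sequentially" by (rule filterlim_subseq)
  then have \<delta>_lim: "\<delta> \<longlonglongrightarrow> 0"
    using filterlim_compose[OF lim_1_over_n[where 'a = real], of "n \<circ> r" sequentially]
    by (simp add: \<delta>_def[abs_def] o_def)
  obtain C where C: "countable C" "\<And>x. x \<in> {0<..<1} - C \<Longrightarrow> (\<lambda>k. V (r k) 0 x) \<longlonglongrightarrow> u 0 x"
    using u_lim[of 0] by auto
  have profile_limit: "b / 4 - b * y \<le> l"
    if "0 \<le> y" "y \<le> 1" "\<And>k. b / 4 - b * (y + \<delta> k)\<^sup>2 \<le> v k" "v \<longlonglongrightarrow> l" for y l v
  proof -
    have lim: "(\<lambda>k. b / 4 - b * (y + \<delta> k)\<^sup>2) \<longlonglongrightarrow> b / 4 - b * (y + 0)\<^sup>2"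
      by (intro tendsto_intros \<delta>_lim)
    have "b / 4 - b * y\<^sup>2 \<le> l"
      using tendsto_le[OF trivial_limit_sequentially that(4) lim] that(3) by simp
    moreover have "b * y\<^sup>2 \<le> b * y" using that(1,2) b by (intro mult_left_mono) (auto simp: power2_eq_square mult_left_le)
    ultimately show ?thesis by simp
  qed
  \<comment> \<open>cell indices are rounded up, which costs at most one cell width \<open>\<delta> k\<close>\<close>
  have init_lower: "b / 4 - b * (y + \<delta> k)\<^sup>2 \<le> W (r k) 0 i"
    if "i \<in> {1..int (N (r k))}" "real_of_int i \<le> real (n (r k)) * y + 1" for i k y
  proof -
    have "i / real (n (r k)) \<le> y + \<delta> k"
      using that(2) n(1)[of "r k"] by (simp add: \<delta>_def field_simps)
    then have "(i / real (n (r k)))\<^sup>2 \<le> (y + \<delta> k)\<^sup>2" using that(1) by (intro power_mono) auto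
    then have "b * (i / real (n (r k)))\<^sup>2 \<le> b * (y + \<delta> k)\<^sup>2" using b by (intro mult_left_mono) auto
    then show ?thesis using init[OF that(1)] by linarith
  qed
  have u0_left: "AE x in unit_leb. x < 1/4 \<longrightarrow> b / 4 - b * x \<le> u 0 x"
  proof (rule AE_unit_leb_countable[OF C(1)], rule impI)
    fix x assume x: "x \<in> {0<..<1} - C" "x < 1/4"
    show "b / 4 - b * x \<le> u 0 x"
    proof (rule profile_limit[OF _ _ _ C(2)[OF x(1)]])
      fix k
      let ?k = "r k"
      have x': "x \<in> {0<..<1}" using x by simp
      have "real (n ?k) * x \<le> real (n ?k) * (1/4)" using x by (intro mult_left_mono) auto
      then have "\<lceil>real (n ?k) * x\<rceil> \<le> int (N ?k)" using n(3)[of ?k] by (simp add: ceiling_le_iff)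
      then show "b / 4 - b * (x + \<delta> k)\<^sup>2 \<le> V ?k 0 x"
        unfolding V_eq[OF T0 x'] using cell[OF x', of ?k] by (intro init_lower) auto
    qed (use x in auto)
  qed
  have u0_right: "AE x in unit_leb. 3/4 < x \<longrightarrow> u 0 x \<le> - (b / 4 - b * (1 - x))"
  proof (rule AE_unit_leb_countable[OF C(1)], rule impI)
    fix x assume x: "x \<in> {0<..<1} - C" "3/4 < x"
    have "b / 4 - b * (1 - x) \<le> - u 0 x"
    proof (rule profile_limit[OF _ _ _ tendsto_minus[OF C(2)[OF x(1)]]])
      fix k
      let ?k = "r k"
      let ?i = "int (n ?k) + 1 - \<lceil>real (n ?k) * x\<rceil>"
      have x': "x \<in> {0<..<1}" using x by simp
      have "real (n ?k) * (3/4) \<le> real (n ?k) * x" using x by (intro mult_left_mono) auto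
      then have "real_of_int ?i \<le> real (N ?k)"
        using cell(2)[OF x', of ?k] n(3)[of ?k] N_ge(2)[of ?k]
        unfolding of_int_diff of_int_add of_int_of_nat_eq of_int_1 by linarith
      then have "?i \<in> {1..int (N ?k)}" using cell(1)[OF x', of ?k] by simp
      moreover have "real_of_int ?i \<le> real (n ?k) * (1 - x) + 1"
        using cell(2)[OF x', of ?k]
        unfolding of_int_diff of_int_add of_int_of_nat_eq of_int_1 right_diff_distrib by linarith
      ultimately show "b / 4 - b * (1 - x + \<delta> k)\<^sup>2 \<le> - V ?k 0 x"
        unfolding V_eq'[OF T0 x'] minus_minus by (rule init_lower)
    qed (use x in auto)
    then show "u 0 x \<le> - (b / 4 - b * (1 - x))" by simp
  qed
  have u_meas: "u t \<in> borel_measurable unit_leb" if "0 \<le> t" for t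
    using u_antimono[OF that] by (rule antimono_on_unit_measurable)
  have Linf_le: "Linf_norm_unit (u t) \<le> ereal (exp (- 2 * \<kappa> * t) * (b / 4))"
    and TV_le: "TV_unit (u t) \<le> ereal (2 * (exp (- 2 * \<kappa> * t) * (b / 4)))" if "0 \<le> t" for t
    by (rule Linf_norm_unit_le[OF u_meas[OF that] u_decay[OF that]],
        rule TV_unit_antimono_le[OF u_antimono[OF that] u_decay[OF that]])
  \<comment> \<open>at time zero the upper bounds by the barrier meet the lower bounds by the initial profile\<close>
  have Linf0: "Linf_norm_unit (u 0) = ereal (b / 4)"
    using Linf_le[of 0] Linf_norm_unit_ge[OF u0_left] b by (intro antisym) auto
  have TV0: "TV_unit (u 0) = ereal (2 * (b / 4))"
    using TV_le[of 0] TV_unit_ge[OF u0_left u0_right] b by (intro antisym) auto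
  have W0_lim: "(\<lambda>k. W (r k) 0 1) \<longlonglongrightarrow> b / 4 + 4 * 0"
    unfolding init1 by (intro tendsto_intros \<epsilon>r_lim)
  have liminf_norm0: "liminf (\<lambda>k. ereal (discr_norm (n (r k)) (W (r k) 0))) = ereal (b / 4)"
    unfolding norm_eq[OF T0] using W0_lim by (intro lim_imp_Liminf) auto
  have "(\<lambda>k. 2 * W (r k) 0 1) \<longlonglongrightarrow> 2 * (b / 4 + 4 * 0)" by (intro tendsto_intros W0_lim)
  then have liminf_TV0: "liminf (\<lambda>k. ereal (discr_TV (n (r k)) (W (r k) 0))) = ereal (2 * (b / 4))"
    unfolding TV_eq[OF T0] by (intro lim_imp_Liminf) auto
  have strict: "Linf_norm_unit (u t) < liminf (\<lambda>k. ereal (discr_norm (n (r k)) (W (r k) t)))"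
    "TV_unit (u t) < liminf (\<lambda>k. ereal (discr_TV (n (r k)) (W (r k) t)))" if t: "0 < t" for t
  proof -
    have E: "exp (- 2 * \<kappa> * t) * (b / 4) < b / 4" using t F.\<kappa> b by simp
    have ev: "\<forall>\<^sub>F k in sequentially. t \<in> {0..T (r k)}"
      using T_large[of t] by eventually_elim (use t in simp)
    have "ereal (b / 4) \<le> liminf (\<lambda>k. ereal (discr_norm (n (r k)) (W (r k) t)))"
    proof (rule Liminf_bounded)
      from ev show "\<forall>\<^sub>F k in sequentially. ereal (b / 4) \<le> ereal (discr_norm (n (r k)) (W (r k) t))"
      proof eventually_elim
        case (elim k)
        then show ?case using norm_eq[OF elim] first(1)[OF elim] by simp
      qed
    qed
    moreover have "Linf_norm_unit (u t) < ereal (b / 4)"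
      by (rule order_le_less_trans[OF Linf_le]) (use E t in auto)
    ultimately show "Linf_norm_unit (u t) < liminf (\<lambda>k. ereal (discr_norm (n (r k)) (W (r k) t)))"
      by (rule order_less_le_trans[rotated])
    have "ereal (2 * (b / 4)) \<le> liminf (\<lambda>k. ereal (discr_TV (n (r k)) (W (r k) t)))"
    proof (rule Liminf_bounded)
      from ev show "\<forall>\<^sub>F k in sequentially. ereal (2 * (b / 4)) \<le> ereal (discr_TV (n (r k)) (W (r k) t))"
      proof eventually_elim
        case (elim k)
        then show ?case using TV_eq[OF elim] first(1)[OF elim] by simp
      qed
    qed
    moreover have "ereal (2 * (exp (- 2 * \<kappa> * t) * (b / 4))) < ereal (2 * (b / 4))"
      using E unfolding less_ereal.simps by linarith
    from order_le_less_trans[OF TV_le[OF less_imp_le[OF t]] this]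
    have "TV_unit (u t) < ereal (2 * (b / 4))" .
    ultimately show "TV_unit (u t) < liminf (\<lambda>k. ereal (discr_TV (n (r k)) (W (r k) t)))"
      by (rule order_less_le_trans[rotated])
  qed
  have "generalized_solution_with \<phi> u (n \<circ> r) (\<lambda>k. W (r k))"
    unfolding generalized_solution_with_def
  proof (intro conjI allI impI ballI)
    show "C0_L2 u" by (rule u_cont)
    show "strict_mono (n \<circ> r)" by fact
    show "0 < (n \<circ> r) k" for k using n(1) by simp
    have "discr_norm ((n \<circ> r) k) (W (r k) 0) + discr_TV ((n \<circ> r) k) (W (r k) 0) \<le> 3 * (b / 4 + 4)" for k
      using norm_eq[OF T0, of "r k"] TV_eq[OF T0, of "r k"] first(2)[OF T0, of "r k"] \<epsilon>(2)[of "r k"] by simp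
    then show "\<exists>M. \<forall>k. discr_norm ((n \<circ> r) k) (W (r k) 0) + discr_TV ((n \<circ> r) k) (W (r k) 0) \<le> M" by blast
    show "((\<lambda>s. W (r k) s i) has_real_derivative
        Dminus ((n \<circ> r) k) (\<lambda>j. deriv \<phi> (Dplus ((n \<circ> r) k) (neumann_ext ((n \<circ> r) k) (W (r k) t)) j)) i)
        (at t within {0..})" if "0 \<le> t" "i \<in> {1..int ((n \<circ> r) k)}" for k t i
      using ode[of t i "r k"] that by (simp add: F.semidiscrete_def)
    fix S :: real assume S: "0 < S"
    let ?L = "\<lambda>k t. L2_norm_unit (\<lambda>x. W (r k) t \<lceil>real ((n \<circ> r) k) * x\<rceil> - u t x)"
    have small: "\<forall>\<^sub>F k in sequentially. (SUP t\<in>{0..S}. ereal (?L k t)) \<le> ereal e" if "0 < e" for e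
      using u_L2[OF that, of S] T_large[of S]
    proof eventually_elim
      case (elim k)
      have "?L k t \<le> e" if t: "t \<in> {0..S}" for t
      proof -
        have "?L k t = L2_norm_unit (\<lambda>x. V (r k) t x - u t x)"
          unfolding L2_norm_unit_def
          by (intro arg_cong[where f = sqrt] Bochner_Integration.integral_cong refl)
             (use V_eq[of t "r k"] t elim in auto)
        then show ?thesis using elim t by simp
      qed
      then show ?case by (intro SUP_least) simp
    qed
    have nonneg: "0 \<le> (SUP t\<in>{0..S}. ereal (?L k t))" for k
      using S by (intro SUP_upper2[of 0]) (auto simp: L2_norm_unit_def)
    show "(\<lambda>k. SUP t\<in>{0..S}. ereal (?L k t)) \<longlonglongrightarrow> 0"
    proof (rule order_tendstoI)
      fix a :: ereal assume "a < 0"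
      then show "\<forall>\<^sub>F k in sequentially. a < (SUP t\<in>{0..S}. ereal (?L k t))"
        using nonneg by (intro always_eventually) (auto intro: less_le_trans)
    next
      fix a :: ereal assume "0 < a"
      then obtain e where e: "0 < e" "ereal e < a" using ereal_dense2[of 0 a] by auto
      show "\<forall>\<^sub>F k in sequentially. (SUP t\<in>{0..S}. ereal (?L k t)) < a"
        using small[OF e(1)] by eventually_elim (use e(2) in auto)
    qed
  qed
  then show ?thesis
    using liminf_norm0 liminf_TV0 Linf0 TV0 strict
    by (intro exI[of _ u] exI[of _ "n \<circ> r"] exI[of _ "\<lambda>k. W (r k)"]) (simp add: o_def)
qed

end
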